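(* Let $\mathbb{M}$ be a strongly regular sequence which admits a nonzero proximate order $\rho(t)$ with $\rho(t)\to\rho>0$ as $t\to\infty$, let $e,E$ be the associated pair of kernel functions for $\mathbb{M}$-summability, and let $m=(m(p))_{p\ge0}$ be the associated sequence of moments. Let $n\ge1$, $A\in\mathbb{C}^{n\times n}$, and let $y=(y_1,\ldots,y_n)$ be a solution of $\partial_m y=Ay$. Then: 1. If $A$ admits a nonzero eigenvalue, then each component of $y$ is either an entire function of order $\rho$ and type at most $\sigma:=\max\{|\lambda|^{\rho}:\lambda\in\mathrm{spec}(A)\}$, or an entire function of order $0$. 2. If $0$ is the only eigenvalue of $A$, then (each component of) $y$ is a polynomial, and therefore its order is zero.
   Context: Strongly regular sequence: a sequence $\mathbb{M}=(M_p)_{p\ge0}$ of positive reals with $M_0=1$ such that (lc) $M_p^2\le M_{p-1}M_{p+1}$ for $p\ge1$; (mg) there is $A_1>0$ with $M_{p+q}\le A_1^{p+q}M_pM_q$ for all $p,q\ge0$; (snq) there is $A_2>0$ with $\sum_{q\ge p}\frac{M_q}{(q+1)M_{q+1}}\le A_2\frac{M_p}{M_{p+1}}$ for all $p\ge0$. Put $M(0)=0$, $M(t)=\sup_{p\ge0}\log(t^p/M_p)$ for $t>0$, $\rho(M)=\limsup_{r\to\infty}\max\{0,\log M(r)/\log r\}$, and $\omega(\mathbb{M})=1/\rho(M)$. Nonzero proximate order: a nonnegative $C^1$ function $\rho(t)$ on some $(c,\infty)$ with $\lim_{r\to\infty}\rho(r)=\rho>0$ and $\lim_{r\to\infty}r\rho'(r)\ln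 r=0$. The sequence $\mathbb{M}$ admits the nonzero proximate order $\rho(t)$ if $\log(t)\left(\rho(t)-\frac{\log M(t)}{\log t}\right)$ is bounded for $t$ large. Sectors: $S_d(\theta)=\{z:|\arg(z)-d|<\theta/2\}$ (on the Riemann surface of the logarithm). $D(z_0,r)$ is the open disc. Pair of kernel functions for $\mathbb{M}$-summability ($0<\omega(\mathbb{M})<2$): functions $e,E$ such that (1) $e$ is holomorphic on $S_0(\omega(\mathbb{M})\pi)$; there is $t_0>0$ such that for every $z_0\in S_0(\omega(\mathbb{M})\pi)$ there is $r_0>0$ with $D(z_0,r_0)\subseteq S_0(\omega(\mathbb{M})\pi)$ and $\int_0^{t_0}\sup_{z\in D(z_0,r_0)}|e(t/z)|\frac{dt}{t}<\infty$; and for every $\delta>0$ there are $k_1,k_2>0$ with $|e(z)|\le k_1\exp(-M(|z|/k_2))$ on $S_0(\omega(\mathbb{M})\pi-\delta)$. (2) $e(|z|)\in\mathbb{R}$ for all $z\in S_0(\omega(\mathbb{M})\pi)$. (3) $E$ is entire, there are $k_3,k_4>0$ with $|E(z)|\le k_3\exp(M(|z|/k_4))$ on $\mathbb{C}$, and there is $\beta>0$ such that for all $0<\theta<2\pi-\omega(\mathbb{M})\pi$ and $R>0$ there is $k_5>0$ with $|E(z)|\le k_5|z|^{-\beta}$ for $z\in S_\pi(\theta)$, $|z|\ge R$. (4) $E(z)=\sum_{p\ge0}\frac{z^p}{m(p)}$, where $m(z)=\int_0^\infty t^{z-1}e(t)\,dt$ for $\mathrm{Re}(z)\ge0$ is continuous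 there and holomorphic for $\mathrm{Re}(z)>0$. The sequence $m=(m(p))_{p\ge0}$ (of positive reals) is the sequence of moments. If $\mathbb{M}$ admits a nonzero proximate order, such a pair exists, and it is fixed. Standing convention on the kernel: the pair associated with $\rho(t)$ is the one for which (by a theorem of Maergoiz recalled in the paper) the entire function $E$ has order $\rho$ and type $1$, with order and type defined as below. Moment derivative: $\partial_m\left(\sum_{p\ge0}\frac{a_p}{m(p)}z^p\right)=\sum_{p\ge0}\frac{a_{p+1}}{m(p)}z^p$ on $\mathbb{C}[[z]]$, extended to functions holomorphic near $0$ via Taylor expansion at $0$, and to vectors componentwise. A solution of $\partial_m y=Ay$ is a vector $y=(y_1,\ldots,y_n)^T$ of such functions satisfying the equation. Order and type: for $f$ entire, $M_f(r)=\max_{|z|=r}|f(z)|$ and $\ln^+=\max\{0,\ln\}$ (with $\ln^+(0)=0$); the order of $f$ is $\rho_f=\limsup_{r\to\infty}\frac{\ln^+(\ln^+(M_f(r)))}{\ln r}$, and if $f$ has (finite) order $\rho$, its type is $\sigma_f=\limsup_{r\to\infty}\frac{\ln^+(M_f(r))}{r^{\rho}}$. *)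

theory Defs
  imports "HOL-Complex_Analysis.Complex_Analysis" "Jordan_Normal_Form.Spectral_Radius"
begin

subsection \<open>Strongly regular sequences\<close>

definition strongly_regular :: "(nat \<Rightarrow> real) \<Rightarrow> bool" where
  "strongly_regular M \<longleftrightarrow>
     (\<forall>p. 0 < M p) \<and> M 0 = 1 \<and>
     (\<forall>p\<ge>1. (M p)\<^sup>2 \<le> M (p - 1) * M (p + 1)) \<and>
     (\<exists>A1>0. \<forall>p q. M (p + q) \<le> A1 ^ (p + q) * M p * M q) \<and>
     (\<exists>A2>0. \<forall>p. summable (\<lambda>k. M (p + k) / (real (p + k + 1) * M (p + k + 1))) \<and>
        (\<Sum>k. M (p + k) / (real (p + k + 1) * M (p + k + 1))) \<le> A2 * (M p / M (p + 1)))"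

text \<open>The real supremum below is meaningful for strongly regular sequences, see
  \<open>bdd_above_assoc_fun\<close>.\<close>

definition assoc_fun :: "(nat \<Rightarrow> real) \<Rightarrow> real \<Rightarrow> real" where
  "assoc_fun M t = (if t \<le> 0 then 0 else (SUP p. ln (t ^ p / M p)))"

definition seq_order :: "(nat \<Rightarrow> real) \<Rightarrow> ereal" where
  "seq_order M = Limsup at_top (\<lambda>r. ereal (max 0 (ln (assoc_fun M r) / ln r)))"

definition seq_omega :: "(nat \<Rightarrow> real) \<Rightarrow> ereal" where
  "seq_omega M = 1 / seq_order M"

lemma bdd_above_assoc_fun:
  assumes M: "strongly_regular M" and t: "0 < t"
  shows "bdd_above (range (\<lambda>p. ln (t ^ p / M p)))"
proof -
  have pos: "0 < M p" for p using M by (auto simp: strongly_regular_def)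
  have lc: "(M (Suc p))\<^sup>2 \<le> M p * M (Suc (Suc p))" for p
  proof -
    have "\<forall>p\<ge>1. (M p)\<^sup>2 \<le> M (p - 1) * M (p + 1)" using M by (simp add: strongly_regular_def)
    from this[rule_format, of "Suc p"] show ?thesis by simp
  qed
  have sm: "summable (\<lambda>k. M k / (real (k + 1) * M (k + 1)))"
  proof -
    have "\<forall>p. summable (\<lambda>k. M (p + k) / (real (p + k + 1) * M (p + k + 1)))"
      using M unfolding strongly_regular_def by blast
    from this[rule_format, of 0] show ?thesis by simp
  qed
  have mono: "incseq (\<lambda>p. M (Suc p) / M p)"
  proof (rule incseq_SucI)
    fix p
    show "M (Suc p) / M p \<le> M (Suc (Suc p)) / M (Suc p)"
      using lc[of p] pos[of p] pos[of "Suc p"]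
      by (simp add: divide_simps power2_eq_square mult.commute)
  qed
  obtain N where N: "t \<le> M (Suc N) / M N"
  proof (rule ccontr)
    assume "\<not> thesis"
    then have lt: "M (Suc k) / M k < t" for k using that not_le by blast
    have le: "1 / t * (1 / real (Suc k)) \<le> M k / (real (k + 1) * M (k + 1))" for k
    proof -
      have "1 / t \<le> M k / M (Suc k)"
        using lt[of k] pos[of k] pos[of "Suc k"] t by (simp add: divide_simps mult.commute)
      then have "1 / t * (1 / real (Suc k)) \<le> M k / M (Suc k) * (1 / real (Suc k))"
        by (rule mult_right_mono) simp
      then show ?thesis by (simp add: mult.commute)
    qed
    have "summable (\<lambda>k. 1 / t * (1 / real (Suc k)))"
    proof (rule summable_comparison_test'[OF sm, of 0])
      show "norm (1 / t * (1 / real (Suc k))) \<le> M k / (real (k + 1) * M (k + 1))" for k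
        using le[of k] t by simp
    qed
    then have "summable (\<lambda>k. 1 / real (Suc k))"
      using t by (subst (asm) summable_cmult_iff) auto
    then show False
      using not_summable_harmonic[where ?'a = real]
        summable_Suc_iff[of "\<lambda>k. 1 / real k"] by (simp add: inverse_eq_divide)
  qed
  have dec: "t ^ (N + j) / M (N + j) \<le> t ^ N / M N" for j
  proof (induction j)
    case (Suc j)
    have "t \<le> M (Suc (N + j)) / M (N + j)"
      using N incseqD[OF mono, of N "N + j"] by simp
    then have "t * M (N + j) \<le> M (Suc (N + j))"
      using pos[of "N + j"] by (simp add: field_simps)
    then have "t ^ (N + j) * (t * M (N + j)) \<le> t ^ (N + j) * M (Suc (N + j))"
      using t by (intro mult_left_mono) auto
    then have "t ^ (N + Suc j) / M (N + Suc j) \<le> t ^ (N + j) / M (N + j)"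
      using pos[of "N + j"] pos[of "Suc (N + j)"] by (simp add: divide_simps mult_ac)
    with Suc show ?case by linarith
  qed simp
  have "ln (t ^ p / M p) \<le> Max ((\<lambda>p. ln (t ^ p / M p)) ` {..N})" for p
  proof (cases "p \<le> N")
    case False
    then obtain j where "p = N + j" by (metis le_add_diff_inverse nat_le_linear)
    then have "t ^ p / M p \<le> t ^ N / M N" using dec by simp
    then have "ln (t ^ p / M p) \<le> ln (t ^ N / M N)"
      using t pos by (subst ln_le_cancel_iff) auto
    also have "\<dots> \<le> Max ((\<lambda>p. ln (t ^ p / M p)) ` {..N})" by (intro Max_ge) auto
    finally show ?thesis .
  qed (auto intro: Max_ge)
  then show ?thesis by (rule bdd_aboveI2)
qed


subsection \<open>Proximate orders\<close>

definition nonzero_proximate_order :: "(real \<Rightarrow> real) \<Rightarrow> real \<Rightarrow> bool" where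
  "nonzero_proximate_order g \<rho> \<longleftrightarrow>
     (\<exists>c. (\<forall>t>c. 0 \<le> g t) \<and> (\<forall>t>c. g differentiable (at t)) \<and>
          continuous_on {c<..} (deriv g)) \<and>
     (g \<longlongrightarrow> \<rho>) at_top \<and> 0 < \<rho> \<and>
     ((\<lambda>r. r * deriv g r * ln r) \<longlongrightarrow> 0) at_top"

definition admits_proximate_order :: "(nat \<Rightarrow> real) \<Rightarrow> (real \<Rightarrow> real) \<Rightarrow> bool" where
  "admits_proximate_order M g \<longleftrightarrow>
     Bfun (\<lambda>t. ln t * (g t - ln (assoc_fun M t) / ln t)) at_top"


subsection \<open>Order and type of entire functions\<close>

definition max_modulus :: "(complex \<Rightarrow> complex) \<Rightarrow> real \<Rightarrow> real" where
  "max_modulus f r = (SUP z\<in>sphere 0 r. cmod (f z))"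

text \<open>As \<^term>\<open>ln (0::real) = 0\<close>, the value at 0 is 0.\<close>

definition ln_plus :: "real \<Rightarrow> real" where
  "ln_plus x = max 0 (ln x)"

definition entire_order :: "(complex \<Rightarrow> complex) \<Rightarrow> ereal" where
  "entire_order f = Limsup at_top (\<lambda>r. ereal (ln_plus (ln_plus (max_modulus f r)) / ln r))"

text \<open>The type is taken with respect to the order of the function itself, and is
  meaningful only if that order is finite.\<close>

definition entire_type :: "(complex \<Rightarrow> complex) \<Rightarrow> ereal" where
  "entire_type f =
     Limsup at_top (\<lambda>r. ereal (ln_plus (max_modulus f r) / r powr real_of_ereal (entire_order f)))"


subsection \<open>Kernel functions\<close>

text \<open>A sector on the Riemann surface of the logarithm is represented by its projection to the
  complex plane, which is injective for openings \<open>\<theta> \<le> 2 * pi\<close>; only such openings occur below.\<close>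

definition sector :: "real \<Rightarrow> real \<Rightarrow> complex set" where
  "sector d \<theta> = {z. \<exists>r>0. \<exists>a. \<bar>a - d\<bar> < \<theta> / 2 \<and> z = rcis r a}"

definition moment_fun :: "(complex \<Rightarrow> complex) \<Rightarrow> complex \<Rightarrow> complex" where
  "moment_fun e z = (LINT t:{0<..}|lborel. of_real t powr (z - 1) * e (of_real t))"

text \<open>The moments are real for kernels \<open>e\<close> that are real on the positive half-line.\<close>

definition moments :: "(complex \<Rightarrow> complex) \<Rightarrow> nat \<Rightarrow> real" where
  "moments e p = Re (moment_fun e (of_nat p))"

definition kernel_pair ::
  "(nat \<Rightarrow> real) \<Rightarrow> (complex \<Rightarrow> complex) \<Rightarrow> (complex \<Rightarrow> complex) \<Rightarrow> bool" where
  "kernel_pair M e E \<longleftrightarrow>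
     0 < seq_omega M \<and> seq_omega M < 2 \<and>
     (let \<omega> = real_of_ereal (seq_omega M); S = sector 0 (\<omega> * pi) in
       e holomorphic_on S \<and>
       (\<exists>t0>0. \<forall>z0\<in>S. \<exists>r0>0. ball z0 r0 \<subseteq> S \<and>
          (\<integral>\<^sup>+t\<in>{0<..t0}. (SUP z\<in>ball z0 r0. ennreal (cmod (e (of_real t / z)))) * ennreal (1 / t)
             \<partial>lborel) < \<infinity>) \<and>
       (\<forall>\<delta>>0. \<exists>k1>0. \<exists>k2>0. \<forall>z\<in>sector 0 (\<omega> * pi - \<delta>).
          cmod (e z) \<le> k1 * exp (- assoc_fun M (cmod z / k2))) \<and>
       (\<forall>z\<in>S. e (of_real (cmod z)) \<in> \<real>) \<and>
       E holomorphic_on UNIV \<and>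
       (\<exists>k3>0. \<exists>k4>0. \<forall>z. cmod (E z) \<le> k3 * exp (assoc_fun M (cmod z / k4))) \<and>
       (\<exists>\<beta>>0. \<forall>\<theta> R. 0 < \<theta> \<and> \<theta> < 2 * pi - \<omega> * pi \<and> 0 < R \<longrightarrow>
          (\<exists>k5>0. \<forall>z\<in>sector pi \<theta>. R \<le> cmod z \<longrightarrow> cmod (E z) \<le> k5 * cmod z powr (- \<beta>))) \<and>
       continuous_on {z. 0 \<le> Re z} (moment_fun e) \<and>
       moment_fun e holomorphic_on {z. 0 < Re z} \<and>
       (\<forall>p. 0 < moments e p) \<and>
       (\<forall>z. (\<lambda>p. z ^ p / of_real (moments e p)) sums E z))"


subsection \<open>Moment differential equations\<close>

definition fps_moment_deriv :: "(nat \<Rightarrow> real) \<Rightarrow> complex fps \<Rightarrow> complex fps" where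
  "fps_moment_deriv m F =
     Abs_fps (\<lambda>p. of_real (m (p + 1)) * fps_nth F (p + 1) / of_real (m p))"

lemma fps_moment_deriv_Abs_fps:
  assumes "\<And>p. m p \<noteq> 0"
  shows "fps_moment_deriv m (Abs_fps (\<lambda>p. a p / of_real (m p))) =
           Abs_fps (\<lambda>p. a (p + 1) / of_real (m p))"
  using assms by (simp add: fps_moment_deriv_def)

text \<open>Moment derivative of germs: \<open>f\<close> and \<open>g\<close> are holomorphic near 0, and the Taylor
  expansion of \<open>g\<close> at 0 is the moment derivative of that of \<open>f\<close>.\<close>

definition has_moment_deriv ::
  "(nat \<Rightarrow> real) \<Rightarrow> (complex \<Rightarrow> complex) \<Rightarrow> (complex \<Rightarrow> complex) \<Rightarrow> bool" where
  "has_moment_deriv m f g \<longleftrightarrow>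
     (\<exists>F. f has_fps_expansion F \<and> g has_fps_expansion fps_moment_deriv m F)"

definition moment_system_solution ::
  "(nat \<Rightarrow> real) \<Rightarrow> nat \<Rightarrow> complex mat \<Rightarrow> (nat \<Rightarrow> complex \<Rightarrow> complex) \<Rightarrow> bool" where
  "moment_system_solution m n A y \<longleftrightarrow>
     (\<forall>i<n. has_moment_deriv m (y i) (\<lambda>z. vec_index (A *\<^sub>v vec n (\<lambda>j. y j z)) i))"

end

theory Submission
  imports Defs "HOL-Probability.Sinc_Integral" "HOL-Real_Asymp.Real_Asymp"
begin

text \<open>Comparing Taylor coefficients turns \<open>\<partial>\<^sub>m y = A y\<close> into \<open>a\<^bsub>p+1\<^esub> = A a\<^sub>p\<close> for the vectors \<open>a\<^sub>p\<close> with
\<open>y(z) = \<Sum> a\<^sub>p z\<^sup>p / m(p)\<close>. So each component of \<open>y\<close> is \<open>f(z) = \<Sum> s\<^sub>p z\<^sup>p / m(p)\<close>, where \<open>s\<^sub>p\<close> is a fixed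
entry of \<open>A\<^sup>p a\<^sub>0\<close>, and it is compared with \<open>E(z) = \<Sum> z\<^sup>p / m(p)\<close>.

Upper bounds. If \<open>r\<close> exceeds the spectral radius of \<open>A\<close>, then \<open>\<bar>s\<^sub>p\<bar> \<le> C r\<^sup>p\<close>
(\<open>linear_iteration_growth\<close>). As the moments are positive, \<open>E\<close> attains its maximum modulus on the
positive half-line, and \<open>max_modulus f x \<le> C * max_modulus E (r * x)\<close>; hence \<open>f\<close> is entire and
grows at most like \<open>exp (c x\<^sup>\<rho>)\<close> for each \<open>c > r\<^sup>\<rho>\<close> (\<open>growth_majorized\<close>). Letting \<open>r\<close> decrease to the
spectral radius gives the bound on the type.

Lower bound. The vectors \<open>a\<^sub>0, \<dots>, a\<^sub>n\<close> are linearly dependent, so \<open>(s\<^sub>p)\<close> satisfies a linear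
recurrence with constant coefficients. Solving it for its earliest term shows that either \<open>s\<close> has
finite support and \<open>f\<close> is a polynomial, or each window of some fixed length \<open>L\<close> contains an index \<open>q\<close> with
\<open>\<bar>s\<^sub>q\<bar> \<ge> C \<kappa>\<^sup>q\<close>, where \<open>C\<close> and \<open>\<kappa>\<close> are positive (\<open>linear_recurrence_dichotomy\<close>). In the second case
Cauchy's inequality for \<open>s\<^sub>q\<close> shows that \<open>f\<close> has order at least \<open>\<rho>\<close>
(\<open>order_ge_if_coeffs_large\<close>): if \<open>E\<close> is large on the circle of radius \<open>x\<close>, some single term
\<open>(2 x)\<^sup>p / m(p)\<close> is large, and the index \<open>p\<close> may be replaced by any \<open>q\<close> in the window after \<open>p\<close> at the
price of a constant factor in \<open>x\<close>. This replacement needs \<open>m(p + 1) \<le> H\<^bsup>p+1\<^esup> m(p)\<close>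
(\<open>moments_Suc_le_power_moments\<close>), which is inherited from the moderate growth of \<open>M\<close>: the decay of \<open>e\<close>
bounds \<open>m(p + 1)\<close> above, and the growth of \<open>E\<close> bounds \<open>m(p)\<close> below, in terms of \<open>M\<close>.

Both parts of the theorem follow: for a nilpotent \<open>A\<close> the bounds \<open>\<bar>s\<^sub>p\<bar> \<le> C r\<^sup>p\<close> hold for all \<open>r > 0\<close>
and rule out the second alternative, so every component is a polynomial.\<close>

section \<open>Order and type of entire functions\<close>

lemma ln_plus_nonneg [simp]: "0 \<le> ln_plus x"
  by (simp add: ln_plus_def)

lemma ln_plus_mono: "0 \<le> x \<Longrightarrow> x \<le> y \<Longrightarrow> ln_plus x \<le> ln_plus y"
  by (cases "x = 0") (auto simp: ln_plus_def max.coboundedI2)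

lemma ln_plus_mult_le: "0 \<le> x \<Longrightarrow> 0 \<le> y \<Longrightarrow> ln_plus (x * y) \<le> ln_plus x + ln_plus y"
  by (cases "x = 0 \<or> y = 0") (auto simp: ln_plus_def ln_mult)

lemma max_modulus_upper:
  assumes "continuous_on UNIV f"
  shows "cmod (f z) \<le> max_modulus f (cmod z)"
proof -
  have "compact ((\<lambda>z. cmod (f z)) ` sphere 0 (cmod z))"
    using assms by (intro compact_continuous_image continuous_intros) (auto intro: continuous_on_subset)
  then have "bdd_above ((\<lambda>z. cmod (f z)) ` sphere 0 (cmod z))"
    by (intro bounded_imp_bdd_above compact_imp_bounded)
  then show ?thesis
    unfolding max_modulus_def by (intro cSUP_upper) auto
qed

lemma max_modulus_least:
  assumes "0 \<le> r" "\<And>z. cmod z = r \<Longrightarrow> cmod (f z) \<le> B"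
  shows "max_modulus f r \<le> B"
proof -
  have "of_real r \<in> sphere (0::complex) r" using assms(1) by simp
  then show ?thesis unfolding max_modulus_def using assms(2) by (intro cSUP_least) auto
qed

lemma max_modulus_nonneg:
  assumes "continuous_on UNIV f" "0 \<le> r"
  shows "0 \<le> max_modulus f r"
  using order_trans[OF norm_ge_zero max_modulus_upper[OF assms(1), of "of_real r"]] assms(2)
  by simp

lemma less_Limsup_imp_frequently:
  fixes f :: "'a \<Rightarrow> ereal"
  assumes "c < Limsup F f"
  shows "\<exists>\<^sub>F x in F. c < f x"
proof (rule ccontr)
  assume "\<not> ?thesis"
  then have "\<forall>\<^sub>F x in F. f x \<le> c" by (simp add: not_frequently not_less)
  then have "Limsup F f \<le> c" by (rule Limsup_bounded)
  with assms show False by simp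
qed

lemma entire_order_nonneg: "0 \<le> entire_order f"
  unfolding entire_order_def
proof (rule le_Limsup)
  show "\<forall>\<^sub>F r in at_top. 0 \<le> ereal (ln_plus (ln_plus (max_modulus f r)) / ln r)"
    using eventually_ge_at_top[of 1] by eventually_elim simp
qed simp

text \<open>An upper bound of the form \<open>K r\<^sup>\<rho>\<close> controls the order because the factor \<open>K\<close> contributes only
\<open>ln K / ln r\<close>, which tends to \<open>0\<close>.\<close>

lemma entire_order_le:
  assumes growth: "\<forall>\<^sub>F r in at_top. ln_plus (max_modulus f r) \<le> K * r powr \<rho>" and \<rho>: "0 \<le> \<rho>"
  shows "entire_order f \<le> ereal \<rho>"
proof -
  define K' where "K' = max 1 K"
  have "\<forall>\<^sub>F r in at_top. ereal (ln_plus (ln_plus (max_modulus f r)) / ln r) \<le> ereal (ln K' / ln r + \<rho>)"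
    using growth eventually_gt_at_top[of 1]
  proof eventually_elim
    case (elim r)
    have "1 \<le> r powr \<rho>" using elim \<rho> by (simp add: ge_one_powr_ge_zero)
    then have "1 * 1 \<le> K' * r powr \<rho>" by (intro mult_mono) (auto simp: K'_def)
    have "K * r powr \<rho> \<le> K' * r powr \<rho>" by (intro mult_right_mono) (auto simp: K'_def)
    then have "ln_plus (ln_plus (max_modulus f r)) \<le> ln_plus (K' * r powr \<rho>)"
      using elim by (intro ln_plus_mono) (auto intro: order_trans)
    also have "\<dots> = ln (K' * r powr \<rho>)"
      using \<open>1 * 1 \<le> K' * r powr \<rho>\<close> by (simp add: ln_plus_def)
    also have "\<dots> = ln K' + \<rho> * ln r"
      using elim by (subst ln_mult) (auto simp: K'_def)
    finally show ?case using elim by (simp add: field_simps)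
  qed
  then have "entire_order f \<le> Limsup at_top (\<lambda>r. ereal (ln K' / ln r + \<rho>))"
    unfolding entire_order_def by (rule Limsup_mono)
  also have "\<dots> = ereal \<rho>"
  proof (rule lim_imp_Limsup)
    have "((\<lambda>r. ln K' / ln r + \<rho>) \<longlongrightarrow> 0 + \<rho>) at_top"
      by (intro tendsto_add tendsto_const tendsto_divide_0[OF tendsto_const]
          filterlim_at_top_imp_at_infinity ln_at_top)
    then show "((\<lambda>r. ereal (ln K' / ln r + \<rho>)) \<longlongrightarrow> ereal \<rho>) at_top" by simp
  qed simp
  finally show ?thesis .
qed

lemma entire_order_ge:
  assumes c: "0 < c" and growth: "\<exists>\<^sub>F r in at_top. c * r powr \<rho> \<le> ln_plus (max_modulus f r)"
  shows "ereal \<rho> \<le> entire_order f"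
proof (rule ccontr)
  assume "\<not> ?thesis"
  then have "entire_order f < ereal \<rho>" by simp
  then obtain \<rho>' where "entire_order f < ereal \<rho>'" and \<rho>': "\<rho>' < \<rho>"
    using ereal_dense2 by (metis ereal_less_eq(3) less_ereal.simps(1))
  then have lt: "\<forall>\<^sub>F r in at_top. ln_plus (ln_plus (max_modulus f r)) / ln r < \<rho>'"
    unfolding entire_order_def by (auto dest!: Limsup_lessD)
  have "\<forall>\<^sub>F r in at_top. - ln c / (\<rho> - \<rho>') \<le> ln r"
    using ln_at_top unfolding filterlim_at_top by blast
  then have "\<forall>\<^sub>F r in at_top. \<not> c * r powr \<rho> \<le> ln_plus (max_modulus f r)"
    using lt eventually_gt_at_top[of 1]
  proof eventually_elim
    case (elim r)
    show ?case
    proof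
      assume "c * r powr \<rho> \<le> ln_plus (max_modulus f r)"
      then have "ln_plus (c * r powr \<rho>) \<le> ln_plus (ln_plus (max_modulus f r))"
        using c by (intro ln_plus_mono) auto
      moreover have "ln (c * r powr \<rho>) = ln c + \<rho> * ln r"
        using elim c by (subst ln_mult) auto
      ultimately have "ln c + \<rho> * ln r \<le> ln_plus (ln_plus (max_modulus f r))"
        by (simp add: ln_plus_def)
      also have "\<dots> < \<rho>' * ln r" using elim by (simp add: field_simps)
      finally show False using elim \<rho>' by (simp add: field_simps)
    qed
  qed
  with growth show False by (simp add: frequently_def)
qed

lemma entire_type_le:
  assumes "entire_order f = ereal \<rho>"
    and "\<forall>\<^sub>F r in at_top. ln_plus (max_modulus f r) \<le> c * r powr \<rho>"
  shows "entire_type f \<le> ereal c"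
  unfolding entire_type_def
proof (rule Limsup_bounded)
  show "\<forall>\<^sub>F r in at_top. ereal (ln_plus (max_modulus f r) / r powr real_of_ereal (entire_order f)) \<le> ereal c"
    using assms(2) eventually_gt_at_top[of 0]
    by eventually_elim (simp add: assms(1) field_simps)
qed

lemma entire_type_less_imp:
  assumes "entire_order f = ereal \<rho>" "entire_type f < ereal c"
  shows "\<forall>\<^sub>F r in at_top. ln_plus (max_modulus f r) \<le> c * r powr \<rho>"
  using Limsup_lessD[OF assms(2)[unfolded entire_type_def]] eventually_gt_at_top[of 0]
  by eventually_elim (simp add: assms(1) field_simps)

lemma less_entire_type_imp:
  assumes "entire_order f = ereal \<rho>" "ereal c < entire_type f"
  shows "\<exists>\<^sub>F r in at_top. c * r powr \<rho> \<le> ln_plus (max_modulus f r)"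
proof (rule frequently_rev_mp[OF less_Limsup_imp_frequently[OF assms(2)[unfolded entire_type_def]]])
  show "\<forall>\<^sub>F r in at_top.
          ereal c < ereal (ln_plus (max_modulus f r) / r powr real_of_ereal (entire_order f)) \<longrightarrow>
          c * r powr \<rho> \<le> ln_plus (max_modulus f r)"
    using eventually_gt_at_top[of 0] by eventually_elim (simp add: assms(1) field_simps)
qed

text \<open>The logarithm of the maximum modulus is \<open>O(ln r)\<close>, hence below a multiple of \<open>r\<^sup>\<epsilon>\<close> for each \<open>\<epsilon> > 0\<close>.\<close>

lemma entire_order_poly: "entire_order (poly p) = 0"
proof (rule antisym[OF _ entire_order_nonneg], rule ereal_le_epsilon2)
  fix \<epsilon> :: real assume \<epsilon>: "0 < \<epsilon>"
  define C where "C = (\<Sum>k\<le>degree p. cmod (coeff p k))"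
  have C: "0 \<le> C" by (simp add: C_def sum_nonneg)
  have "\<forall>\<^sub>F r in at_top. ln_plus (max_modulus (poly p) r) \<le> (ln_plus C + real (degree p) / \<epsilon>) * r powr \<epsilon>"
    using eventually_gt_at_top[of 1]
  proof eventually_elim
    case (elim r)
    have "max_modulus (poly p) r \<le> C * r ^ degree p"
    proof (rule max_modulus_least)
      fix z assume z: "cmod z = r"
      have "cmod (poly p z) \<le> (\<Sum>k\<le>degree p. cmod (coeff p k) * r ^ k)"
        unfolding poly_altdef by (rule order_trans[OF norm_sum]) (simp add: norm_mult norm_power z)
      also have "\<dots> \<le> (\<Sum>k\<le>degree p. cmod (coeff p k) * r ^ degree p)"
        using elim by (intro sum_mono mult_left_mono power_increasing) auto
      finally show "cmod (poly p z) \<le> C * r ^ degree p" by (simp add: C_def sum_distrib_right)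
    qed (use elim in auto)
    then have "ln_plus (max_modulus (poly p) r) \<le> ln_plus (C * r ^ degree p)"
      using elim by (intro ln_plus_mono max_modulus_nonneg continuous_intros) auto
    also have "\<dots> \<le> ln_plus C + ln_plus (r ^ degree p)"
      using C elim by (intro ln_plus_mult_le) auto
    also have "ln_plus (r ^ degree p) = real (degree p) * ln r"
      using elim by (simp add: ln_plus_def ln_realpow)
    also have "\<dots> \<le> real (degree p) * (r powr \<epsilon> / \<epsilon>)"
      using ln_powr_bound[of r \<epsilon>] elim \<epsilon> by (intro mult_left_mono) auto
    also have "ln_plus C \<le> ln_plus C * r powr \<epsilon>"
      using elim \<epsilon> mult_left_mono[of 1 "r powr \<epsilon>" "ln_plus C"] by (simp add: ge_one_powr_ge_zero)
    finally show ?case by (simp add: algebra_simps)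
  qed
  then show "entire_order (poly p) \<le> 0 + ereal \<epsilon>"
    using entire_order_le \<epsilon> by simp
qed

section \<open>Moments and the defining sequence\<close>

lemma strongly_regular_pos: "strongly_regular M \<Longrightarrow> 0 < M p"
  by (simp add: strongly_regular_def)

lemma power_div_le_exp_assoc_fun:
  assumes M: "strongly_regular M" and t: "0 < t"
  shows "t ^ j / M j \<le> exp (assoc_fun M t)"
proof -
  have "ln (t ^ j / M j) \<le> assoc_fun M t"
    using cSUP_upper[OF UNIV_I bdd_above_assoc_fun[OF M t], of j] t by (simp add: assoc_fun_def)
  then have "exp (ln (t ^ j / M j)) \<le> exp (assoc_fun M t)" by simp
  then show ?thesis
    using strongly_regular_pos[OF M, of j] t by simp
qed

text \<open>By logarithmic convexity the quotients \<open>M\<^bsub>p+1\<^esub> / M\<^sub>p\<close> increase, so at \<open>t = M\<^bsub>p+1\<^esub> / M\<^sub>p\<close> the sequence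
\<open>t\<^sup>j / M\<^sub>j\<close> increases up to \<open>j = p\<close> and decreases afterwards. Thus every \<open>M\<^sub>p\<close> can be recovered from the
associated function.\<close>

lemma exp_assoc_fun_attained:
  assumes M: "strongly_regular M"
  obtains t where "0 < t" "exp (assoc_fun M t) = t ^ p / M p"
proof -
  note pos = strongly_regular_pos[OF M]
  have lc: "(M (Suc p))\<^sup>2 \<le> M p * M (Suc (Suc p))" for p
  proof -
    have "\<forall>p\<ge>1. (M p)\<^sup>2 \<le> M (p - 1) * M (p + 1)" using M by (simp add: strongly_regular_def)
    from this[rule_format, of "Suc p"] show ?thesis by simp
  qed
  have mono: "incseq (\<lambda>p. M (Suc p) / M p)"
  proof (rule incseq_SucI)
    fix p
    show "M (Suc p) / M p \<le> M (Suc (Suc p)) / M (Suc p)"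
      using lc[of p] pos[of p] pos[of "Suc p"]
      by (simp add: divide_simps power2_eq_square mult.commute)
  qed
  define t where "t = M (Suc p) / M p"
  have t: "0 < t" using pos by (simp add: t_def)
  have up: "t ^ j / M j \<le> t ^ p / M p" if "p \<le> j" for j
    using that
  proof (induction j rule: dec_induct)
    case (step k)
    have "t * M k \<le> M (Suc k)"
      using incseqD[OF mono step(1)] pos[of k] by (simp add: t_def field_simps)
    then have "t ^ k * (t * M k) \<le> t ^ k * M (Suc k)" using t by (intro mult_left_mono) auto
    then have "t ^ Suc k / M (Suc k) \<le> t ^ k / M k"
      using pos[of k] pos[of "Suc k"] by (simp add: divide_simps mult_ac)
    with step show ?case by linarith
  qed simp
  have down: "t ^ j / M j \<le> t ^ p / M p" if "j \<le> p" for j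
    using that
  proof (induction j rule: inc_induct)
    case (step k)
    have "M (Suc k) \<le> t * M k"
      using incseqD[OF mono, of k p] step(2) pos[of k] by (simp add: t_def field_simps)
    then have "t ^ k * M (Suc k) \<le> t ^ k * (t * M k)" using t by (intro mult_left_mono) auto
    then have "t ^ k / M k \<le> t ^ Suc k / M (Suc k)"
      using pos[of k] pos[of "Suc k"] by (simp add: divide_simps mult_ac)
    with step show ?case by linarith
  qed simp
  have "(SUP j. ln (t ^ j / M j)) = ln (t ^ p / M p)"
  proof (rule cSup_eq_maximum)
    show "x \<le> ln (t ^ p / M p)" if "x \<in> range (\<lambda>j. ln (t ^ j / M j))" for x
      using that up down pos t by (auto intro!: ln_mono) (meson nat_le_linear)
  qed auto
  then have "exp (assoc_fun M t) = t ^ p / M p"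
    using t pos[of p] by (simp add: assoc_fun_def)
  with t show thesis by (rule that)
qed

lemma kernel_pair_moments_pos: "kernel_pair M e E \<Longrightarrow> 0 < moments e p"
  by (simp add: kernel_pair_def Let_def)

lemma kernel_pair_sums: "kernel_pair M e E \<Longrightarrow> (\<lambda>p. z ^ p / of_real (moments e p)) sums E z"
  by (simp add: kernel_pair_def Let_def)

lemma kernel_pair_holomorphic: "kernel_pair M e E \<Longrightarrow> E holomorphic_on UNIV"
  by (simp add: kernel_pair_def Let_def)

lemma kernel_pair_real_sums:
  assumes K: "kernel_pair M e E"
  shows "(\<lambda>p. x ^ p / moments e p) sums Re (E (of_real x))"
proof -
  have "(\<lambda>p. of_real (x ^ p / moments e p)) sums E (of_real x)"
    using kernel_pair_sums[OF K, of "of_real x"] by simp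
  from sums_Re[OF this] show ?thesis by (simp only: Re_complex_of_real)
qed

lemma kernel_pair_term_le:
  assumes K: "kernel_pair M e E" and x: "0 \<le> x"
  shows "x ^ p / moments e p \<le> Re (E (of_real x))"
proof -
  note s = kernel_pair_real_sums[OF K, of x]
  have "sum (\<lambda>q. x ^ q / moments e q) {p} \<le> (\<Sum>q. x ^ q / moments e q)"
    using kernel_pair_moments_pos[OF K] x
    by (intro sum_le_suminf sums_summable[OF s]) (auto intro!: divide_nonneg_pos)
  then show ?thesis using sums_unique[OF s] by simp
qed

text \<open>The positive half-line lies in every sector around direction \<open>0\<close>; the choice \<open>\<delta> = \<omega> \<pi> / 2\<close> gives one
of positive opening.\<close>

lemma kernel_pair_kernel_decay:
  assumes K: "kernel_pair M e E"
  obtains k1 k2 where "0 < k1" "0 < k2"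
    "\<And>t. 0 < t \<Longrightarrow> cmod (e (of_real t)) \<le> k1 * exp (- assoc_fun M (t / k2))"
proof -
  define w where "w = real_of_ereal (seq_omega M)"
  have w: "0 < w"
    using K unfolding kernel_pair_def w_def
    by (cases "seq_omega M") (auto simp: numeral_eq_ereal)
  have "\<forall>\<delta>>0. \<exists>k1>0. \<exists>k2>0. \<forall>z\<in>sector 0 (w * pi - \<delta>).
          cmod (e z) \<le> k1 * exp (- assoc_fun M (cmod z / k2))"
    using K unfolding kernel_pair_def w_def Let_def by (elim conjE) assumption
  moreover have "0 < w * pi / 2" using w by simp
  ultimately obtain k1 k2 where k: "0 < k1" "0 < k2"
    and b: "\<And>z. z \<in> sector 0 (w * pi - w * pi / 2) \<Longrightarrow>
          cmod (e z) \<le> k1 * exp (- assoc_fun M (cmod z / k2))" by blast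
  have "of_real t \<in> sector 0 (w * pi - w * pi / 2)" if "0 < t" for t
  proof -
    have "\<bar>0 - 0\<bar> < (w * pi - w * pi / 2) / 2 \<and> complex_of_real t = rcis t 0"
      using w by (simp add: rcis_def)
    with that show ?thesis unfolding sector_def by blast
  qed
  from b[OF this] k that show thesis by fastforce
qed

text \<open>The decay of the kernel makes both \<open>t\<^sup>p \<bar>e(t)\<bar>\<close> and \<open>t\<^bsup>p+2\<^esup> \<bar>e(t)\<bar>\<close> bounded, by constants that agree
up to geometric factors with \<open>M\<^sub>p\<close> and \<open>M\<^bsub>p+2\<^esub>\<close>. The sum of these bounds dominates \<open>(1 + t\<^sup>2) t\<^sup>p \<bar>e(t)\<bar>\<close>, so
that the moment integral is at most this sum times the integral of \<open>1 / (1 + t\<^sup>2)\<close>.\<close>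

lemma moments_Suc_le:
  assumes M: "strongly_regular M" and K: "kernel_pair M e E"
  obtains C k where "0 < C" "0 < k"
    "\<And>p. moments e (p + 1) \<le> C * (M p * k ^ p + M (p + 2) * k ^ (p + 2))"
proof -
  note pos = strongly_regular_pos[OF M]
  obtain k1 k where k: "0 < k1" "0 < k"
    and dec: "\<And>t. 0 < t \<Longrightarrow> cmod (e (of_real t)) \<le> k1 * exp (- assoc_fun M (t / k))"
    using kernel_pair_kernel_decay[OF K] by blast
  define I where "I = (LINT t:{0<..}|lborel. 1 / (1 + t ^ 2) :: real)"
  have int: "set_integrable lborel {0<..} (\<lambda>t::real. 1 / (1 + t\<^sup>2))"
    using integrable_I0i_1_div_plus_square
    by (simp add: interval_lebesgue_integrable_def einterval_def greaterThan_def zero_ereal_def)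
  have I: "0 \<le> I"
    unfolding I_def set_lebesgue_integral_def by (intro Bochner_Integration.integral_nonneg) (auto simp: indicator_def)
  have bound: "moments e (p + 1) \<le> (k1 * (I + 1)) * (M p * k ^ p + M (p + 2) * k ^ (p + 2))" for p
  proof -
    define B where "B = k1 * (M p * k ^ p + M (p + 2) * k ^ (p + 2))"
    have B: "0 \<le> B" using k pos[of p] pos[of "p + 2"] by (simp add: B_def)
    have pw: "cmod (of_real t powr (of_nat (p + 1) - 1) * e (of_real t)) \<le> B * (1 / (1 + t\<^sup>2))"
      if t: "0 < t" for t
    proof -
      define x where "x = exp (- assoc_fun M (t / k))"
      have le: "t ^ j * x \<le> M j * k ^ j" for j
        using power_div_le_exp_assoc_fun[OF M, of "t / k" j] t k pos[of j]
        by (simp add: x_def exp_minus field_simps)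
      have "t ^ p * x * (1 + t\<^sup>2) = t ^ p * x + t ^ (p + 2) * x"
        by (simp add: algebra_simps power_add power2_eq_square)
      also have "\<dots> \<le> M p * k ^ p + M (p + 2) * k ^ (p + 2)"
        by (intro add_mono le)
      finally have 1: "k1 * (t ^ p * x * (1 + t\<^sup>2)) \<le> B"
        using k by (simp add: B_def)
      have "complex_of_real t powr (of_nat (p + 1) - 1) = of_real (t ^ p)"
        using t by (simp add: powr_nat')
      then have "cmod (of_real t powr (of_nat (p + 1) - 1) * e (of_real t)) = t ^ p * cmod (e (of_real t))"
        using t by (simp add: norm_mult norm_power)
      also have "\<dots> \<le> t ^ p * (k1 * x)"
        unfolding x_def using t by (intro mult_left_mono dec) auto
      also have "\<dots> \<le> B * (1 / (1 + t\<^sup>2))"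
      proof -
        have "0 < 1 + t\<^sup>2" by (simp add: add_pos_nonneg)
        with 1 show ?thesis by (simp add: field_simps)
      qed
      finally show ?thesis .
    qed
    have "moments e (p + 1) \<le> cmod (moment_fun e (of_nat (p + 1)))"
      unfolding moments_def by (rule complex_Re_le_cmod)
    also have "\<dots> \<le> (LINT t:{0<..}|lborel. B * (1 / (1 + t\<^sup>2)))"
      unfolding moment_fun_def set_lebesgue_integral_def
    proof (cases "integrable lborel (\<lambda>t. indicator {0<..} t *\<^sub>R
        (complex_of_real t powr (of_nat (p + 1) - 1) * e (of_real t)))")
      case True
      then show "cmod (LINT t|lborel. indicator {0<..} t *\<^sub>R
            (complex_of_real t powr (of_nat (p + 1) - 1) * e (of_real t)))
          \<le> (LINT t|lborel. indicator {0<..} t *\<^sub>R (B * (1 / (1 + t\<^sup>2))))"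
      proof (rule Bochner_Integration.integral_norm_bound_integral)
        show "integrable lborel (\<lambda>t. indicator {0<..} t *\<^sub>R (B * (1 / (1 + t\<^sup>2))) :: real)"
          using set_integrable_mult_right[OF int, of B] by (simp add: set_integrable_def)
        show "cmod (indicator {0<..} t *\<^sub>R (complex_of_real t powr (of_nat (p + 1) - 1) * e (of_real t)))
            \<le> indicator {0<..} t *\<^sub>R (B * (1 / (1 + t\<^sup>2)))" for t
          using pw[of t] by (simp add: indicator_def)
      qed
    next
      \<comment> \<open>the Bochner integral of a non-integrable function is 0\<close>
      case False
      have "0 \<le> (LINT t|lborel. indicator {0<..} t *\<^sub>R (B * (1 / (1 + t\<^sup>2))) :: real)"
        using B by (intro Bochner_Integration.integral_nonneg) (auto simp: indicator_def)
      with not_integrable_integral_eq[OF False]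
      show "cmod (LINT t|lborel. indicator {0<..} t *\<^sub>R
            (complex_of_real t powr (of_nat (p + 1) - 1) * e (of_real t)))
          \<le> (LINT t|lborel. indicator {0<..} t *\<^sub>R (B * (1 / (1 + t\<^sup>2))))"
        by simp
    qed
    also have "\<dots> = B * I"
      unfolding I_def by (simp only: set_integral_mult_right)
    also have "\<dots> \<le> B * (I + 1)" using B by (simp add: mult_left_mono)
    finally show ?thesis by (simp add: B_def mult_ac)
  qed
  show thesis
    by (rule that[OF _ k(2) bound]) (use k I in auto)
qed

text \<open>A single term of the series of \<open>E\<close> is at most \<open>k\<^sub>3 exp (M(x / k\<^sub>4))\<close>; evaluate at the point where the
exponential equals its \<open>p\<close>-th term \<open>(x / k\<^sub>4)\<^sup>p / M\<^sub>p\<close>.\<close>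

lemma regular_le_moments:
  assumes M: "strongly_regular M" and K: "kernel_pair M e E"
  obtains C k where "0 < C" "0 < k" "\<And>p. M p \<le> C * k ^ p * moments e p"
proof -
  note pos = strongly_regular_pos[OF M] and mpos = kernel_pair_moments_pos[OF K]
  have "\<exists>k3>0. \<exists>k4>0. \<forall>z. cmod (E z) \<le> k3 * exp (assoc_fun M (cmod z / k4))"
    using K unfolding kernel_pair_def Let_def by (elim conjE) assumption
  then obtain k3 k4 where k: "0 < k3" "0 < k4"
    and b: "\<And>z. cmod (E z) \<le> k3 * exp (assoc_fun M (cmod z / k4))" by blast
  have "M p \<le> k3 * (1 / k4) ^ p * moments e p" for p
  proof -
    obtain t where t: "0 < t" and eq: "exp (assoc_fun M t) = t ^ p / M p"
      using exp_assoc_fun_attained[OF M] by blast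
    have "(k4 * t) ^ p / moments e p \<le> Re (E (of_real (k4 * t)))"
      by (rule kernel_pair_term_le[OF K]) (use k t in simp)
    also have "\<dots> \<le> cmod (E (of_real (k4 * t)))" by (rule complex_Re_le_cmod)
    also have "\<dots> \<le> k3 * (t ^ p / M p)"
      using b[of "of_real (k4 * t)"] k t by (simp add: eq norm_mult)
    finally show ?thesis
      using k t pos[of p] mpos[of p] by (simp add: field_simps power_mult_distrib)
  qed
  with k show thesis by (intro that[of k3 "1 / k4"]) auto
qed

text \<open>Moderate growth passes from \<open>M\<close> to \<open>m\<close>: it bounds the upper estimate of \<open>m(p + 1)\<close> by a geometric
factor times \<open>M\<^sub>p\<close>, and \<open>M\<^sub>p\<close> is in turn at most a geometric factor times \<open>m(p)\<close>.\<close>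

lemma moments_Suc_le_power_moments:
  assumes M: "strongly_regular M" and K: "kernel_pair M e E"
  obtains H where "1 \<le> H" "\<And>p. moments e (p + 1) \<le> H ^ (p + 1) * moments e p"
proof -
  note pos = strongly_regular_pos[OF M] and mpos = kernel_pair_moments_pos[OF K]
  obtain C k where C: "0 < C" "0 < k"
    and up: "\<And>p. moments e (p + 1) \<le> C * (M p * k ^ p + M (p + 2) * k ^ (p + 2))"
    using moments_Suc_le[OF M K] by blast
  obtain C' k' where C': "0 < C'" "0 < k'" and lo: "\<And>p. M p \<le> C' * k' ^ p * moments e p"
    using regular_le_moments[OF M K] by blast
  obtain A where A: "0 < A" and mg: "\<And>p q. M (p + q) \<le> A ^ (p + q) * M p * M q"
    using M unfolding strongly_regular_def by blast
  define D where "D = C * C' * (1 + (A * k)\<^sup>2 * M 2)"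
  \<comment> \<open>the maxima make all factors at least 1, so that \<open>p\<close>-th powers may be replaced by powers with exponent \<open>p + 1\<close>\<close>
  define b where "b = max 1 A"
  define H where "H = max 1 D * (b * max 1 k * max 1 k')"
  have D: "0 < D" unfolding D_def using C C' A pos[of 2]
    by (intro mult_pos_pos add_pos_pos) auto
  have "moments e (p + 1) \<le> H ^ (p + 1) * moments e p" for p
  proof -
    have "1 \<le> b ^ p" by (simp add: b_def)
    have Ab: "A ^ p \<le> b ^ p" using A by (intro power_mono) (auto simp: b_def)
    have "M p * k ^ p + M (p + 2) * k ^ (p + 2)
        \<le> M p * k ^ p + A ^ (p + 2) * M p * M 2 * k ^ (p + 2)"
      using mg[of p 2] C by (intro add_mono mult_right_mono) auto
    also have "\<dots> = M p * k ^ p * (1 + A ^ p * ((A * k)\<^sup>2 * M 2))"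
      by (simp add: algebra_simps power_add power2_eq_square)
    also have "\<dots> \<le> M p * k ^ p * (b ^ p + b ^ p * ((A * k)\<^sup>2 * M 2))"
      using pos[of p] pos[of 2] C \<open>1 \<le> b ^ p\<close> Ab
      by (intro mult_left_mono add_mono mult_right_mono) auto
    also have "\<dots> = M p * ((b * k) ^ p * (1 + (A * k)\<^sup>2 * M 2))"
      by (simp add: algebra_simps power_mult_distrib)
    also have "\<dots> \<le> (C' * k' ^ p * moments e p) * ((b * k) ^ p * (1 + (A * k)\<^sup>2 * M 2))"
      using lo[of p] pos[of 2] C by (intro mult_right_mono) (auto simp: b_def)
    finally have "moments e (p + 1)
        \<le> C * ((C' * k' ^ p * moments e p) * ((b * k) ^ p * (1 + (A * k)\<^sup>2 * M 2)))"
      using up[of p] C by (meson mult_left_mono order_trans less_imp_le)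
    also have "\<dots> = D * (b * k * k') ^ p * moments e p"
      by (simp add: D_def power_mult_distrib mult_ac)
    also have "\<dots> \<le> (max 1 D * max 1 D ^ p) * (b * max 1 k * max 1 k') ^ Suc p * moments e p"
    proof (intro mult_right_mono mult_mono)
      have "1 * D \<le> max 1 D ^ p * max 1 D" using D by (intro mult_mono) auto
      then show "D \<le> max 1 D * max 1 D ^ p" by (simp add: mult.commute)
      have "(b * k * k') ^ p \<le> (b * max 1 k * max 1 k') ^ p"
        using C C' by (intro power_mono mult_mono) (auto simp: b_def)
      also have "\<dots> \<le> (b * max 1 k * max 1 k') ^ Suc p"
      proof (rule power_increasing)
        have "1 * 1 * 1 \<le> b * max 1 k * max 1 k'" by (intro mult_mono) (auto simp: b_def)
        then show "1 \<le> b * max 1 k * max 1 k'" by simp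
      qed simp
      finally show "(b * k * k') ^ p \<le> (b * max 1 k * max 1 k') ^ Suc p" .
    qed (use mpos[of p] C C' in \<open>auto simp: b_def less_imp_le\<close>)
    also have "\<dots> = H ^ (p + 1) * moments e p"
      by (simp add: H_def power_mult_distrib mult_ac)
    finally show ?thesis .
  qed
  moreover have "1 \<le> H"
  proof -
    have "1 * (1 * 1 * 1) \<le> H" unfolding H_def by (intro mult_mono) (auto simp: b_def)
    then show ?thesis by simp
  qed
  ultimately show thesis using that by blast
qed

section \<open>Power series compared with the kernel\<close>

lemma coeff_le_max_modulus:
  fixes F :: "complex fps"
  assumes F: "fps_conv_radius F = \<infinity>" and r: "0 < r"
  shows "cmod (fps_nth F q) * r ^ q \<le> max_modulus (eval_fps F) r"
proof -
  have hol: "eval_fps F holomorphic_on UNIV"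
    using holomorphic_on_eval_fps[of UNIV F] F by simp
  have "cmod ((deriv ^^ q) (eval_fps F) 0) \<le> fact q * max_modulus (eval_fps F) r / r ^ q"
  proof (rule Cauchy_inequality)
    show "cmod (eval_fps F x) \<le> max_modulus (eval_fps F) r" if "cmod (0 - x) = r" for x
      using that max_modulus_upper[of "eval_fps F" x] holomorphic_on_imp_continuous_on[OF hol] by simp
  qed (use r hol in \<open>auto intro: holomorphic_on_subset holomorphic_on_imp_continuous_on\<close>)
  moreover have "fps_nth F q = (deriv ^^ q) (eval_fps F) 0 / fact q"
    using F by (intro fps_nth_conv_deriv) auto
  ultimately have "cmod (fps_nth F q) \<le> max_modulus (eval_fps F) r / r ^ q"
    by (simp add: norm_divide divide_le_eq mult.commute)
  then show ?thesis using r by (simp add: field_simps)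
qed

lemma
  fixes F :: "complex fps"
  assumes m: "\<And>p. 0 < m p"
    and E: "\<And>z. (\<lambda>p. z ^ p / of_real (m p)) sums E z"
    and r: "0 < r" and C: "\<And>p. cmod (fps_nth F p) \<le> C * r ^ p / m p"
  shows fps_conv_radius_majorized: "fps_conv_radius F = \<infinity>"
    and max_modulus_majorized:
      "continuous_on UNIV E \<Longrightarrow> 0 \<le> x \<Longrightarrow> max_modulus (eval_fps F) x \<le> C * max_modulus E (r * x)"
proof -
  have dom: "(\<lambda>p. C * (r * x) ^ p / m p) sums (C * Re (E (of_real (r * x))))" for x
  proof -
    have "(\<lambda>p. of_real ((r * x) ^ p / m p)) sums E (of_real (r * x))"
      using E[of "of_real (r * x)"] by (simp add: power_mult_distrib)
    from sums_mult[OF sums_Re[OF this], of C] show ?thesis by (simp only: Re_complex_of_real times_divide_eq_right)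
  qed
  have le: "cmod (fps_nth F p * z ^ p) \<le> C * (r * cmod z) ^ p / m p" for p z
    using mult_right_mono[OF C[of p], of "cmod z ^ p"]
    by (simp add: norm_mult norm_power power_mult_distrib mult_ac)
  have "summable (\<lambda>p. fps_nth F p * z ^ p)" for z
    by (rule summable_comparison_test'[OF sums_summable[OF dom[of "cmod z"]], of 0]) (rule le)
  then show "fps_conv_radius F = \<infinity>"
    unfolding fps_conv_radius_def by (intro conv_radius_inftyI'') auto
  have C0: "0 \<le> C" using order_trans[OF norm_ge_zero C[of 0]] m[of 0] by (simp add: zero_le_divide_iff)
  show "max_modulus (eval_fps F) x \<le> C * max_modulus E (r * x)"
    if "continuous_on UNIV E" "0 \<le> x"
  proof (rule max_modulus_least)
    fix z :: complex assume z: "cmod z = x"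
    have "cmod (eval_fps F z) \<le> (\<Sum>p. C * (r * x) ^ p / m p)"
      unfolding eval_fps_def using le[of _ z] z
      by (intro norm_suminf_le sums_summable[OF dom]) auto
    also have "\<dots> = C * Re (E (of_real (r * x)))" using sums_unique[OF dom] by simp
    also have "\<dots> \<le> C * max_modulus E (r * x)"
      using max_modulus_upper[OF that(1), of "of_real (r * x)"] that r C0
      by (intro mult_left_mono order_trans[OF complex_Re_le_cmod]) (auto simp: norm_mult abs_mult)
    finally show "cmod (eval_fps F z) \<le> C * max_modulus E (r * x)" .
  qed (use that in auto)
qed

lemma powr_filterlim_at_top:
  assumes "0 < (\<rho>::real)"
  shows "filterlim (\<lambda>x::real. x powr \<rho>) at_top at_top"
  using assms by real_asymp

text \<open>Majorization by \<open>C * E (r * x)\<close> scales the type by \<open>r\<^sup>\<rho>\<close>; the constant \<open>C\<close> is absorbed by the strict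
inequality \<open>r\<^sup>\<rho> < c\<close>.\<close>

lemma growth_majorized:
  fixes F :: "complex fps"
  assumes m: "\<And>p. 0 < m p"
    and E: "\<And>z. (\<lambda>p. z ^ p / of_real (m p)) sums E z" "continuous_on UNIV E"
    and ord: "entire_order E = ereal \<rho>" "entire_type E = 1" and \<rho>: "0 < \<rho>"
    and r: "0 < r" and C: "\<And>p. cmod (fps_nth F p) \<le> C * r ^ p / m p"
    and c: "r powr \<rho> < c"
  shows "\<forall>\<^sub>F x in at_top. ln_plus (max_modulus (eval_fps F) x) \<le> c * x powr \<rho>"
proof -
  have "1 < c / r powr \<rho>" using c r by (simp add: field_simps)
  \<comment> \<open>since \<open>E\<close> has type 1, it grows at most at rate \<open>d > 1\<close>; the gap between \<open>d r\<^sup>\<rho>\<close> and \<open>c\<close> is left for \<open>ln C\<close>\<close>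
  then obtain d where d: "1 < d" "d < c / r powr \<rho>" using dense by blast
  then have d': "0 < c - d * r powr \<rho>" using r by (simp add: field_simps)
  have "entire_type E < ereal d" using ord d by (simp add: one_ereal_def)
  from entire_type_less_imp[OF ord(1) this]
  have "\<forall>\<^sub>F x in at_top. ln_plus (max_modulus E (r * x)) \<le> d * (r * x) powr \<rho>"
    by (rule eventually_compose_filterlim)
      (rule filterlim_tendsto_pos_mult_at_top[OF tendsto_const r filterlim_ident])
  moreover have "\<forall>\<^sub>F x in at_top. ln_plus C / (c - d * r powr \<rho>) \<le> x powr \<rho>"
    using powr_filterlim_at_top[OF \<rho>] unfolding filterlim_at_top by blast
  ultimately show ?thesis using eventually_gt_at_top[of 0]
  proof eventually_elim
    case (elim x)
    have cont: "continuous_on UNIV (eval_fps F)"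
      using fps_conv_radius_majorized[OF m E(1) r C]
      by (intro holomorphic_on_imp_continuous_on holomorphic_on_eval_fps) auto
    have C0: "0 \<le> C" using order_trans[OF norm_ge_zero C[of 0]] m[of 0] by (simp add: zero_le_divide_iff)
    have "ln_plus (max_modulus (eval_fps F) x) \<le> ln_plus (C * max_modulus E (r * x))"
      using elim by (intro ln_plus_mono max_modulus_majorized[OF m E(1) r C E(2)] max_modulus_nonneg cont) auto
    also have "\<dots> \<le> ln_plus C + ln_plus (max_modulus E (r * x))"
      using elim r C0 by (intro ln_plus_mult_le max_modulus_nonneg E(2)) auto
    also have "\<dots> \<le> (c - d * r powr \<rho>) * x powr \<rho> + d * (r * x) powr \<rho>"
      using elim d' by (intro add_mono) (auto simp: field_simps)
    also have "\<dots> = c * x powr \<rho>"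
      using elim r by (simp add: powr_mult algebra_simps)
    finally show ?case .
  qed
qed

text \<open>If the coefficients of \<open>F\<close> are written as \<open>s\<^sub>q / m(q)\<close>, then \<open>low\<close> says that \<open>\<bar>s\<^sub>q\<bar> \<ge> c \<kappa>\<^sup>q\<close> for some \<open>q\<close> in each
window of length \<open>L\<close>. A lower bound for \<open>E\<close> at radius \<open>x\<close> becomes one for \<open>F\<close> at radius \<open>B x\<close>, where \<open>B\<close>
compensates both the geometric loss \<open>\<kappa>\<^sup>q\<close> in \<open>s\<^sub>q\<close> and the geometric loss \<open>D\<^sup>q\<close> in passing from \<open>m(p)\<close> to
\<open>m(q)\<close>.\<close>

lemma order_ge_if_coeffs_large:
  fixes F :: "complex fps"
  assumes m: "\<And>p. 0 < m p" and D: "0 < D" "\<And>p q. p \<le> q \<Longrightarrow> q < p + L \<Longrightarrow> m q \<le> D ^ q * m p"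
    and E: "\<And>z. (\<lambda>p. z ^ p / of_real (m p)) sums E z" "continuous_on UNIV E"
    and ord: "entire_order E = ereal \<rho>" "entire_type E = 1" and \<rho>: "0 < \<rho>"
    and F: "fps_conv_radius F = \<infinity>"
    and c: "0 < c" "0 < \<kappa>"
    and low: "\<And>p. \<exists>q. p \<le> q \<and> q < p + L \<and> c * \<kappa> ^ q \<le> m q * cmod (fps_nth F q)"
  shows "ereal \<rho> \<le> entire_order (eval_fps F)"
proof -
  define B where "B = 2 * D / \<kappa>"
  have B: "0 < B" using D c by (simp add: B_def)
  have key: "c * exp (x powr \<rho> / 2) / 4 \<le> max_modulus (eval_fps F) (B * x)"
    if big: "x powr \<rho> / 2 \<le> ln_plus (max_modulus E x)" and x: "1 \<le> x" for x
  proof -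
    define b where "b = exp (x powr \<rho> / 2) / 4"
    have "0 < x powr \<rho> / 2" using x by simp
    then have "x powr \<rho> / 2 \<le> ln (max_modulus E x)" using big unfolding ln_plus_def by linarith
    moreover have "0 < max_modulus E x"
    proof -
      have "max_modulus E x \<noteq> 0"
        using calculation \<open>0 < x powr \<rho> / 2\<close> by (intro notI) simp
      with max_modulus_nonneg[OF E(2), of x] x show ?thesis by linarith
    qed
    ultimately have "exp (x powr \<rho> / 2) \<le> max_modulus E x" using ln_ge_iff by blast
    then have large: "4 * b \<le> max_modulus E x" by (simp add: b_def)
    \<comment> \<open>otherwise \<open>E\<close> would be dominated on the circle by a geometric series of ratio \<open>1 / 2\<close>\<close>
    obtain p where p: "b \<le> (2 * x) ^ p / m p"
    proof (rule ccontr)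
      assume "\<not> thesis"
      then have lt: "(2 * x) ^ p / m p \<le> b" for p using that[of p] by linarith
      have "max_modulus E x \<le> 2 * b"
      proof (rule max_modulus_least)
        fix z :: complex assume z: "cmod z = x"
        have geo: "(\<lambda>p. b * (1 / 2) ^ p) sums (b * 2)"
          using sums_mult[OF geometric_sums[of "1 / 2 :: real"], of b] by simp
        have "cmod (\<Sum>p. z ^ p / of_real (m p)) \<le> (\<Sum>p. b * (1 / 2) ^ p)"
        proof (rule norm_suminf_le)
          fix p
          have "cmod (z ^ p / of_real (m p)) = (2 * x) ^ p / m p * (1 / 2) ^ p"
            using m[of p] by (simp add: norm_divide norm_power z power_mult_distrib power_divide)
          also have "\<dots> \<le> b * (1 / 2) ^ p" by (intro mult_right_mono lt) auto
          finally show "cmod (z ^ p / of_real (m p)) \<le> b * (1 / 2) ^ p" .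
        qed (use geo in \<open>rule sums_summable\<close>)
        then show "cmod (E z) \<le> 2 * b"
          using sums_unique[OF E(1)[of z]] sums_unique[OF geo] by (simp add: mult.commute)
      qed (use x in auto)
      moreover have "0 < b" by (simp add: b_def)
      ultimately show False using large by linarith
    qed
    from low[of p] obtain q where q: "p \<le> q" "q < p + L" "c * \<kappa> ^ q \<le> m q * cmod (fps_nth F q)"
      by blast
    have "c * exp (x powr \<rho> / 2) / 4 = c * b" by (simp add: b_def)
    also have "\<dots> \<le> c * ((2 * x) ^ q / m p)"
    proof -
      have "(2 * x) ^ p / m p \<le> (2 * x) ^ q / m p"
        using x q m[of p] by (intro divide_right_mono power_increasing) auto
      with p c show ?thesis by (intro mult_left_mono) auto
    qed
    also have "\<dots> = c * \<kappa> ^ q * (B * x) ^ q / (D ^ q * m p)"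
      using D c m[of p] by (simp add: B_def power_mult_distrib power_divide)
    also have "\<dots> \<le> c * \<kappa> ^ q * (B * x) ^ q / m q"
      using D(2)[OF q(1,2)] c B x m[of p] m[of q] D(1) by (intro divide_left_mono) auto
    also have "\<dots> \<le> (m q * cmod (fps_nth F q)) * (B * x) ^ q / m q"
      using q(3) B x m[of q] by (intro divide_right_mono mult_right_mono) auto
    also have "\<dots> = cmod (fps_nth F q) * (B * x) ^ q" using m[of q] by simp
    also have "\<dots> \<le> max_modulus (eval_fps F) (B * x)"
      using B x by (intro coeff_le_max_modulus F) auto
    finally show ?thesis .
  qed
  have "\<forall>\<^sub>F x in at_top. - 4 * ln (c / 4) \<le> x powr \<rho>"
    using powr_filterlim_at_top[OF \<rho>] unfolding filterlim_at_top by blast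
  then have ev: "\<forall>\<^sub>F x in at_top. 1 / 2 * x powr \<rho> \<le> ln_plus (max_modulus E x) \<longrightarrow>
      1 / (4 * B powr \<rho>) * (B * x) powr \<rho> \<le> ln_plus (max_modulus (eval_fps F) (B * x))"
    using eventually_ge_at_top[of 1]
  proof eventually_elim
    case (elim x)
    show ?case
    proof
      assume "1 / 2 * x powr \<rho> \<le> ln_plus (max_modulus E x)"
      then have le: "c * exp (x powr \<rho> / 2) / 4 \<le> max_modulus (eval_fps F) (B * x)"
        using elim by (intro key) auto
      have "ln (c * exp (x powr \<rho> / 2) / 4) = ln (c / 4) + x powr \<rho> / 2"
        using c ln_mult[of "c / 4" "exp (x powr \<rho> / 2)"] by simp
      then have "x powr \<rho> / 4 \<le> ln (c * exp (x powr \<rho> / 2) / 4)"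
        using elim(1) by linarith
      also have "\<dots> \<le> ln_plus (c * exp (x powr \<rho> / 2) / 4)"
        by (simp add: ln_plus_def)
      also have "\<dots> \<le> ln_plus (max_modulus (eval_fps F) (B * x))"
        using c by (intro ln_plus_mono le) auto
      finally show "1 / (4 * B powr \<rho>) * (B * x) powr \<rho> \<le> ln_plus (max_modulus (eval_fps F) (B * x))"
        using elim B by (simp add: powr_mult)
    qed
  qed
  \<comment> \<open>type 1 provides arbitrarily large radii at which \<open>ln_plus (max_modulus E x)\<close> exceeds \<open>x\<^sup>\<rho> / 2\<close>\<close>
  have "ereal (1 / 2) < entire_type E" using ord by (simp add: one_ereal_def)
  from frequently_rev_mp[OF less_entire_type_imp[OF ord(1) this] ev]
  have fr: "\<exists>\<^sub>F x in at_top. 1 / (4 * B powr \<rho>) * (B * x) powr \<rho> \<le> ln_plus (max_modulus (eval_fps F) (B * x))" .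
  have "\<exists>\<^sub>F y in at_top. 1 / (4 * B powr \<rho>) * y powr \<rho> \<le> ln_plus (max_modulus (eval_fps F) y)"
  proof (rule ccontr)
    assume "\<not> ?thesis"
    then have "\<forall>\<^sub>F y in at_top. \<not> 1 / (4 * B powr \<rho>) * y powr \<rho> \<le> ln_plus (max_modulus (eval_fps F) y)"
      by (simp add: frequently_def)
    then have "\<forall>\<^sub>F x in at_top. \<not> 1 / (4 * B powr \<rho>) * (B * x) powr \<rho> \<le> ln_plus (max_modulus (eval_fps F) (B * x))"
      by (rule eventually_compose_filterlim)
        (rule filterlim_tendsto_pos_mult_at_top[OF tendsto_const B filterlim_ident])
    with fr show False by (simp add: frequently_def)
  qed
  then show ?thesis using B by (intro entire_order_ge[of "1 / (4 * B powr \<rho>)"]) auto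
qed

section \<open>Iterates of a matrix\<close>

text \<open>Let \<open>c\<^sub>j\<close> be the first nonzero coefficient. The recurrence then expresses each \<open>s\<^sub>q\<close> with \<open>q \<ge> j\<close> through
the \<open>n - j\<close> terms after it, so \<open>\<bar>s\<^sub>q\<bar>\<close> is at most \<open>K\<close> times their maximum. Going back from a distant window
to a fixed nonzero term \<open>s\<^bsub>p0\<^esub>\<close> with \<open>p0 \<ge> j\<close> costs at most a power of \<open>K\<close>, so the terms of the
window at \<open>p\<close> cannot all be smaller than a fixed multiple of \<open>K\<^bsup>-p\<^esup>\<close>. If there is no such term, \<open>s\<close> vanishes from \<open>j\<close> on.\<close>

lemma linear_recurrence_dichotomy:
  fixes s c :: "nat \<Rightarrow> complex"
  assumes nz: "k0 \<le> n" "c k0 \<noteq> 0" and rec: "\<And>p. (\<Sum>k\<le>n. c k * s (p + k)) = 0"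
  obtains N where "\<And>p. N \<le> p \<Longrightarrow> s p = 0"
  | L C \<kappa> where "0 < C" "0 < \<kappa>" "\<And>p. \<exists>q. p \<le> q \<and> q < p + L \<and> C * \<kappa> ^ q \<le> cmod (s q)"
proof -
  define j where "j = (LEAST k. c k \<noteq> 0)"
  have j: "c j \<noteq> 0" "j \<le> n" and below: "\<And>k. k < j \<Longrightarrow> c k = 0"
    unfolding j_def using LeastI[of "\<lambda>k. c k \<noteq> 0", OF nz(2)] Least_le[of "\<lambda>k. c k \<noteq> 0", OF nz(2)] nz(1)
      not_less_Least by auto
  define K where "K = max 1 ((\<Sum>k\<le>n. cmod (c k)) / cmod (c j))"
  have K: "1 \<le> K" by (simp add: K_def)
  have backward: "cmod (s (p + j)) \<le> K * b"
    if b: "\<And>k. j < k \<Longrightarrow> k \<le> n \<Longrightarrow> cmod (s (p + k)) \<le> b" "0 \<le> b" for p b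
  proof -
    have "(\<Sum>k\<le>n. c k * s (p + k)) = (\<Sum>k\<in>{j..n}. c k * s (p + k))"
      using below by (intro sum.mono_neutral_right) (auto simp: not_le)
    also have "\<dots> = c j * s (p + j) + (\<Sum>k\<in>{j<..n}. c k * s (p + k))"
      using j by (simp add: sum.head)
    finally have "c j * s (p + j) = - (\<Sum>k\<in>{j<..n}. c k * s (p + k))"
      using rec[of p] by (simp add: eq_neg_iff_add_eq_0)
    then have "cmod (c j) * cmod (s (p + j)) = cmod (\<Sum>k\<in>{j<..n}. c k * s (p + k))"
      by (metis norm_minus_cancel norm_mult)
    also have "\<dots> \<le> (\<Sum>k\<in>{j<..n}. cmod (c k) * b)"
      using b by (intro order_trans[OF norm_sum] sum_mono) (auto simp: norm_mult intro: mult_left_mono)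
    also have "\<dots> \<le> (\<Sum>k\<le>n. cmod (c k) * b)"
      using b by (intro sum_mono2) auto
    also have "\<dots> = cmod (c j) * ((\<Sum>k\<le>n. cmod (c k)) / cmod (c j) * b)"
      using j by (simp add: sum_distrib_right)
    also have "\<dots> \<le> cmod (c j) * (K * b)"
      using b by (intro mult_left_mono mult_right_mono) (auto simp: K_def)
    finally show ?thesis using j by simp
  qed
  show thesis
  proof (cases "\<exists>p0\<ge>j. s p0 \<noteq> 0")
    case False
    then show thesis by (intro that(1)[of j]) auto
  next
    case True
    then obtain p0 where p0: "j \<le> p0" "s p0 \<noteq> 0" by blast
    have window: "cmod (s p0) \<le> K ^ p * b"
      if "\<And>q. p + p0 \<le> q \<Longrightarrow> q \<le> p + p0 + n \<Longrightarrow> cmod (s q) \<le> b" "0 \<le> b" for p b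
      using that
    proof (induction p arbitrary: b)
      case 0
      then show ?case by simp
    next
      case (Suc p)
      have "b \<le> K * b" using mult_right_mono[OF K Suc.prems(2)] by simp
      have "cmod (s q) \<le> K * b" if q: "p + p0 \<le> q" "q \<le> p + p0 + n" for q
      proof (cases "q = p + p0")
        case True
        have "cmod (s (p + p0 - j + j)) \<le> K * b"
          using p0 j Suc.prems by (intro backward) auto
        then show ?thesis using p0 True by simp
      next
        case False
        then show ?thesis using Suc.prems(1)[of q] q \<open>b \<le> K * b\<close> by auto
      qed
      then have "cmod (s p0) \<le> K ^ p * (K * b)"
        using K Suc.prems by (intro Suc.IH) auto
      then show ?case by (simp add: mult_ac)
    qed
    \<comment> \<open>the window that starts at \<open>p\<close> is lengthened so as to contain the one that starts at \<open>p + p0\<close>\<close>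
    show thesis
    proof (rule that(2)[of "cmod (s p0) / 2" "1 / K" "p0 + n + 1"])
      fix p
      show "\<exists>q\<ge>p. q < p + (p0 + n + 1) \<and> cmod (s p0) / 2 * (1 / K) ^ q \<le> cmod (s q)"
      proof (rule ccontr)
        assume "\<not> ?thesis"
        then have small: "cmod (s q) < cmod (s p0) / 2 * (1 / K) ^ q"
          if "p \<le> q" "q < p + (p0 + n + 1)" for q using that by (meson not_le)
        have "cmod (s p0) \<le> K ^ p * (cmod (s p0) / 2 * (1 / K) ^ p)"
        proof (rule window)
          fix q assume q: "p + p0 \<le> q" "q \<le> p + p0 + n"
          have "cmod (s q) \<le> cmod (s p0) / 2 * (1 / K) ^ q" using small[of q] q by simp
          also have "\<dots> \<le> cmod (s p0) / 2 * (1 / K) ^ p"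
            using q K by (intro mult_left_mono power_decreasing) auto
          finally show "cmod (s q) \<le> cmod (s p0) / 2 * (1 / K) ^ p" .
        qed (use K in auto)
        also have "\<dots> = cmod (s p0) / 2" using K by (simp add: power_divide)
        finally show False using p0 by simp
      qed
    qed (use p0 K in auto)
  qed
qed

text \<open>The \<open>n + 1\<close> vectors \<open>a\<^sub>0, \<dots>, a\<^sub>n\<close> of length \<open>n\<close> are linearly dependent, and the iteration carries a linear
relation between them over to all later windows. The relation is a kernel vector of the square matrix
that has these vectors as columns, completed by a zero row.\<close>

lemma linear_iteration_annihilated:
  fixes a :: "nat \<Rightarrow> nat \<Rightarrow> complex"
  assumes step: "\<And>p i. i < n \<Longrightarrow> a (Suc p) i = (\<Sum>j<n. B i j * a p j)"
  obtains c k0 where "k0 \<le> n" "c k0 \<noteq> 0" "\<And>p i. i < n \<Longrightarrow> (\<Sum>k\<le>n. c k * a (p + k) i) = 0"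
proof -
  define W where "W = mat\<^sub>r (Suc n) (Suc n)
      (\<lambda>i. if i = n then 0\<^sub>v (Suc n) else vec (Suc n) (\<lambda>k. a k i))"
  have W: "W \<in> carrier_mat (Suc n) (Suc n)" by (simp add: W_def)
  have "det W = 0" unfolding W_def by (rule det_row_0) auto
  then obtain v where v: "v \<in> carrier_vec (Suc n)" "v \<noteq> 0\<^sub>v (Suc n)" "W *\<^sub>v v = 0\<^sub>v (Suc n)"
    using det_0_iff_vec_prod_zero_field[OF W] by blast
  have "\<exists>k0\<le>n. v $ k0 \<noteq> 0"
  proof (rule ccontr)
    assume "\<not> ?thesis"
    then have "v = 0\<^sub>v (Suc n)" using v(1) by (intro eq_vecI) auto
    with v show False by simp
  qed
  then obtain k0 where k0: "k0 \<le> n" "v $ k0 \<noteq> 0" by blast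
  have base: "(\<Sum>k\<le>n. v $ k * a k i) = 0" if i: "i < n" for i
  proof -
    have "(W *\<^sub>v v) $ i = (\<Sum>k\<in>{0..<Suc n}. a k i * v $ k)"
      using i v(1) by (simp add: W_def scalar_prod_def)
    then show ?thesis using v(3) i by (simp add: atLeast0LessThan lessThan_Suc_atMost mult.commute)
  qed
  have "(\<Sum>k\<le>n. v $ k * a (p + k) i) = 0" if "i < n" for p i
    using that
  proof (induction p arbitrary: i)
    case (Suc p)
    have "(\<Sum>k\<le>n. v $ k * a (Suc p + k) i) = (\<Sum>k\<le>n. \<Sum>j<n. B i j * (v $ k * a (p + k) j))"
      using Suc.prems by (simp add: step sum_distrib_left mult_ac)
    also have "\<dots> = (\<Sum>j<n. B i j * (\<Sum>k\<le>n. v $ k * a (p + k) j))"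
      by (subst sum.swap) (simp add: sum_distrib_left)
    also have "\<dots> = 0" using Suc.IH by simp
    finally show ?case .
  qed (use base in simp)
  with k0 show thesis by (rule that)
qed

lemma linear_iteration_pow_mat:
  fixes A :: "'a :: comm_ring_1 mat"
  assumes A: "A \<in> carrier_mat n n"
    and step: "\<And>p i. i < n \<Longrightarrow> a (Suc p) i = (\<Sum>j<n. A $$ (i, j) * a p j)"
    and i: "i < n"
  shows "a (p + q) i = (\<Sum>j<n. (A ^\<^sub>m p) $$ (i, j) * a q j)"
proof (induction p arbitrary: q)
  case 0
  have "(\<Sum>j<n. (A ^\<^sub>m 0) $$ (i, j) * a q j) = (\<Sum>j<n. if j = i then a q j else 0)"
    using A i by (intro sum.cong) auto
  also have "\<dots> = a q i" using i by simp
  finally show ?case by simp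
next
  case (Suc p)
  have P: "A ^\<^sub>m p \<in> carrier_mat n n" using A by simp
  have "(\<Sum>j<n. (A ^\<^sub>m Suc p) $$ (i, j) * a q j)
      = (\<Sum>j<n. \<Sum>k<n. (A ^\<^sub>m p) $$ (i, k) * A $$ (k, j) * a q j)"
    using A P i by (intro sum.cong) (auto simp: scalar_prod_def atLeast0LessThan sum_distrib_right)
  also have "\<dots> = (\<Sum>k<n. (A ^\<^sub>m p) $$ (i, k) * (\<Sum>j<n. A $$ (k, j) * a q j))"
    by (subst sum.swap) (simp add: sum_distrib_left mult.assoc)
  also have "\<dots> = (\<Sum>k<n. (A ^\<^sub>m p) $$ (i, k) * a (Suc q) k)" by (simp add: step)
  also have "\<dots> = a (p + Suc q) i" by (rule Suc.IH[symmetric])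
  finally show ?case by simp
qed

lemma linear_iteration_bounded:
  fixes A :: "complex mat"
  assumes A: "A \<in> carrier_mat n n" and sr: "spectral_radius A < 1"
    and step: "\<And>p i. i < n \<Longrightarrow> a (Suc p) i = (\<Sum>j<n. A $$ (i, j) * a p j)"
    and i: "i < n"
  obtains C where "\<And>p. cmod (a p i) \<le> C"
proof -
  obtain b where b: "\<And>k. norm_bound (A ^\<^sub>m k) b"
    using spectral_radius_jnf_norm_bound_less_1_upper_triangular[OF A sr] by blast
  have "cmod (a p i) \<le> (\<Sum>j<n. b * cmod (a 0 j))" for p
  proof -
    have "a p i = (\<Sum>j<n. (A ^\<^sub>m p) $$ (i, j) * a 0 j)"
      using linear_iteration_pow_mat[where a = a and q = 0, OF A step i] by simp
    also have "cmod \<dots> \<le> (\<Sum>j<n. b * cmod (a 0 j))"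
      using b[of p] A i
      by (intro order_trans[OF norm_sum] sum_mono) (auto simp: norm_mult norm_bound_def intro!: mult_right_mono)
    finally show ?thesis .
  qed
  then show thesis by (rule that)
qed

text \<open>The rescaled iterates \<open>a\<^sub>p / r\<^sup>p\<close> belong to the matrix \<open>A / r\<close>, whose spectral radius is less than \<open>1\<close>.\<close>

lemma linear_iteration_growth:
  fixes A :: "complex mat"
  assumes A: "A \<in> carrier_mat n n" and r: "spectral_radius A < r" "0 < r"
    and step: "\<And>p i. i < n \<Longrightarrow> a (Suc p) i = (\<Sum>j<n. A $$ (i, j) * a p j)"
    and i: "i < n"
  obtains C where "\<And>p. cmod (a p i) \<le> C * r ^ p"
proof -
  define B where "B = complex_of_real (1 / r) \<cdot>\<^sub>m A"
  have B: "B \<in> carrier_mat n n" using A by (simp add: B_def)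
  have n: "0 < n" using i by simp
  have "spectral_radius B < 1"
  proof -
    from spectral_radius_mem_max(1)[OF B n] obtain l where l: "l \<in> spectrum B" "spectral_radius B = cmod l"
      by auto
    then obtain v where v: "v \<in> carrier_vec n" "v \<noteq> 0\<^sub>v n" "B *\<^sub>v v = l \<cdot>\<^sub>v v"
      using B unfolding spectrum_def eigenvalue_def eigenvector_def by auto
    have "A = of_real r \<cdot>\<^sub>m B" using r A by (intro eq_matI) (auto simp: B_def)
    then have "A *\<^sub>v v = of_real r \<cdot>\<^sub>v (B *\<^sub>v v)" using B v(1) by auto
    then have "A *\<^sub>v v = (of_real r * l) \<cdot>\<^sub>v v" using v by (simp add: smult_smult_assoc)
    then have "of_real r * l \<in> spectrum A"
      using A v unfolding spectrum_def eigenvalue_def eigenvector_def by auto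
    then have "cmod (of_real r * l) \<le> spectral_radius A"
      using spectral_radius_mem_max(2)[OF A n] by blast
    then have "r * cmod l \<le> spectral_radius A" using r by (simp add: norm_mult)
    then have "cmod l * r < 1 * r" using r(1) by (simp only: mult.commute mult_1_right)
    then show ?thesis unfolding l(2) using r(2) by (simp only: mult_less_cancel_right_pos)
  qed
  moreover have "a (Suc p) i / of_real r ^ Suc p = (\<Sum>j<n. B $$ (i, j) * (a p j / of_real r ^ p))"
    if "i < n" for p i
    using that A by (simp add: step B_def sum_divide_distrib)
  ultimately obtain C where "\<And>p. cmod (a p i / of_real r ^ p) \<le> C"
    using linear_iteration_bounded[where a = "\<lambda>p i. a p i / of_real r ^ p", OF B _ _ i] by blast
  then have "cmod (a p i) \<le> C * r ^ p" for p
    using r by (simp add: norm_divide norm_power divide_le_eq)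
  then show thesis by (rule that)
qed

section \<open>Moment differential systems\<close>

text \<open>Chaining \<open>k\<close> of the one-step bounds from \<open>p\<close> to \<open>p + k\<close> gives at most the factor \<open>H\<^bsup>k (p + k)\<^esup>\<close>, which is
geometric in \<open>q = p + k\<close> as long as \<open>k < L\<close>.\<close>

lemma iterate_moment_ratio_bound:
  fixes m :: "nat \<Rightarrow> real"
  assumes m: "\<And>p. 0 < m p" and H: "1 \<le> H" "\<And>p. m (p + 1) \<le> H ^ (p + 1) * m p"
    and q: "p \<le> q" "q < p + L"
  shows "m q \<le> (H ^ L) ^ q * m p"
proof -
  have "m (p + k) \<le> H ^ (k * (p + k)) * m p" for k
  proof (induction k)
    case (Suc k)
    have "m (p + Suc k) \<le> H ^ (p + Suc k) * m (p + k)" using H(2)[of "p + k"] by simp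
    also have "\<dots> \<le> H ^ (p + Suc k) * (H ^ (k * (p + k)) * m p)"
      using Suc H by (intro mult_left_mono) auto
    also have "\<dots> = H ^ (p + Suc k + k * (p + k)) * m p" by (simp add: power_add)
    also have "\<dots> \<le> H ^ (Suc k * (p + Suc k)) * m p"
      using H m[of p] by (intro mult_right_mono power_increasing) (auto simp: algebra_simps)
    finally show ?case .
  qed simp
  from this[of "q - p"] have "m q \<le> H ^ ((q - p) * q) * m p" using q by simp
  also have "\<dots> \<le> H ^ (L * q) * m p"
    using H m[of p] q by (intro mult_right_mono power_increasing mult_le_mono1) auto
  finally show ?thesis by (simp add: power_mult)
qed

text \<open>Both sides of the system are germs with a Taylor expansion, so uniqueness of Taylor coefficients turns
the differential system into the iteration \<open>a\<^bsub>p+1\<^esub> = A a\<^sub>p\<close> for \<open>a\<^sub>p = m(p) F\<^sub>p\<close>.\<close>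

lemma moment_system_solution_fps:
  assumes A: "A \<in> carrier_mat n n" and sol: "moment_system_solution m n A y"
    and m: "\<And>p. m p \<noteq> 0"
  obtains F where "\<And>i. i < n \<Longrightarrow> y i has_fps_expansion F i"
    "\<And>p i. i < n \<Longrightarrow> of_real (m (Suc p)) * fps_nth (F i) (Suc p)
        = (\<Sum>j<n. A $$ (i, j) * (of_real (m p) * fps_nth (F j) p))"
proof -
  have "\<forall>i. \<exists>G. i < n \<longrightarrow> y i has_fps_expansion G \<and>
      (\<lambda>z. (A *\<^sub>v vec n (\<lambda>j. y j z)) $ i) has_fps_expansion fps_moment_deriv m G"
    using sol unfolding moment_system_solution_def has_moment_deriv_def by blast
  then obtain F where F: "\<And>i. i < n \<Longrightarrow> y i has_fps_expansion F i"
    and dF: "\<And>i. i < n \<Longrightarrow>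
      (\<lambda>z. (A *\<^sub>v vec n (\<lambda>j. y j z)) $ i) has_fps_expansion fps_moment_deriv m (F i)"
    by metis
  have "of_real (m (Suc p)) * fps_nth (F i) (Suc p)
        = (\<Sum>j<n. A $$ (i, j) * (of_real (m p) * fps_nth (F j) p))" if i: "i < n" for p i
  proof -
    have "(\<lambda>z. (A *\<^sub>v vec n (\<lambda>j. y j z)) $ i) = (\<lambda>z. \<Sum>j<n. A $$ (i, j) * y j z)"
      using A i by (auto simp: scalar_prod_def atLeast0LessThan)
    then have "(\<lambda>z. \<Sum>j<n. A $$ (i, j) * y j z) has_fps_expansion fps_moment_deriv m (F i)"
      using dF[OF i] by simp
    moreover have "(\<lambda>z. \<Sum>j<n. A $$ (i, j) * y j z)
        has_fps_expansion (\<Sum>j<n. fps_const (A $$ (i, j)) * F j)"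
      by (intro has_fps_expansion_sum has_fps_expansion_cmult_left F) auto
    ultimately have "fps_moment_deriv m (F i) $ p = (\<Sum>j<n. fps_const (A $$ (i, j)) * F j) $ p"
      by (simp only: fps_nth_fps_expansion)
    then have "of_real (m (p + 1)) * fps_nth (F i) (p + 1) / of_real (m p) = (\<Sum>j<n. A $$ (i, j) * fps_nth (F j) p)"
      by (simp add: fps_moment_deriv_def fps_sum_nth)
    then show ?thesis using m[of p]
      by (simp add: divide_eq_eq sum_distrib_left mult_ac)
  qed
  with F show thesis by (rule that)
qed

lemma eval_fps_finite_support:
  fixes F :: "complex fps"
  assumes "\<And>k. N \<le> k \<Longrightarrow> fps_nth F k = 0"
  obtains p where "eval_fps F = poly p"
proof
  have "F = fps_of_poly (\<Sum>k<N. monom (fps_nth F k) k)"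
    by (rule fps_ext) (use assms in \<open>auto simp: coeff_sum not_less\<close>)
  then show "eval_fps F = poly (\<Sum>k<N. monom (fps_nth F k) k)"
    by (metis eval_fps_of_poly ext)
qed

lemma less_powr_obtain:
  fixes R \<rho> c :: real
  assumes "0 < R" "0 < \<rho>" "R powr \<rho> < c"
  obtains r where "R < r" "r powr \<rho> < c"
proof -
  obtain d where d: "R powr \<rho> < d" "d < c" using dense[OF assms(3)] by blast
  have "0 < R powr \<rho>" using assms by simp
  then have d0: "0 < d" using d by linarith
  have "(R powr \<rho>) powr (1 / \<rho>) < d powr (1 / \<rho>)"
    using d assms by (intro powr_less_mono2) auto
  then have "R < d powr (1 / \<rho>)" using assms by (simp add: powr_powr)
  moreover have "(d powr (1 / \<rho>)) powr \<rho> < c" using assms d d0 by (simp add: powr_powr)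
  ultimately show thesis by (rule that)
qed

theorem theorem5:
  fixes M :: "nat \<Rightarrow> real" and g :: "real \<Rightarrow> real" and \<rho> :: real
    and e E :: "complex \<Rightarrow> complex"
    and n :: nat and A :: "complex mat" and y :: "nat \<Rightarrow> complex \<Rightarrow> complex"
  assumes "strongly_regular M"
    and "nonzero_proximate_order g \<rho>"
    and "admits_proximate_order M g"
    and "kernel_pair M e E"
    and "entire_order E = ereal \<rho>" and "entire_type E = 1"
    and "1 \<le> n" and "A \<in> carrier_mat n n"
    and "moment_system_solution (moments e) n A y"
  shows "((\<exists>l\<in>spectrum A. l \<noteq> 0) \<longrightarrow>
            (\<forall>i<n. \<exists>f. f holomorphic_on UNIV \<and> (\<forall>\<^sub>F z in nhds 0. y i z = f z) \<and>
               (entire_order f = ereal \<rho> \<and>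
                  entire_type f \<le> ereal (Max ((\<lambda>l. cmod l powr \<rho>) ` spectrum A)) \<or>
                entire_order f = 0))) \<and>
         (spectrum A = {0} \<longrightarrow>
            (\<forall>i<n. \<exists>p :: complex poly. (\<forall>\<^sub>F z in nhds 0. y i z = poly p z) \<and>
               entire_order (poly p) = 0))"
proof -
  note K = assms(4) and A = assms(8)
  define m where "m = moments e"
  define R where "R = spectral_radius A"
  have \<rho>: "0 < \<rho>" using assms(2) by (simp add: nonzero_proximate_order_def)
  have m: "0 < m p" for p using kernel_pair_moments_pos[OF K] by (simp add: m_def)
  have E: "(\<lambda>p. z ^ p / of_real (m p)) sums E z" for z using kernel_pair_sums[OF K] by (simp add: m_def)
  have contE: "continuous_on UNIV E"
    using kernel_pair_holomorphic[OF K] by (rule holomorphic_on_imp_continuous_on)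
  obtain H where H: "1 \<le> H" "\<And>p. m (p + 1) \<le> H ^ (p + 1) * m p"
    using moments_Suc_le_power_moments[OF assms(1) K] unfolding m_def by blast
  have m0: "moments e p \<noteq> 0" for p using m[of p] by (simp add: m_def)
  obtain F where F: "\<And>i. i < n \<Longrightarrow> y i has_fps_expansion F i"
    and F_step: "\<And>p i. i < n \<Longrightarrow> of_real (m (Suc p)) * fps_nth (F i) (Suc p)
        = (\<Sum>j<n. A $$ (i, j) * (of_real (m p) * fps_nth (F j) p))"
    using moment_system_solution_fps[OF A assms(9) m0] unfolding m_def by blast
  define a where "a p i = of_real (m p) * fps_nth (F i) p" for p i
  have step: "a (Suc p) i = (\<Sum>j<n. A $$ (i, j) * a p j)" if "i < n" for p i
    using F_step[OF that] by (simp add: a_def)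
  have ev: "\<forall>\<^sub>F z in nhds 0. y i z = eval_fps (F i) z" if "i < n" for i
    using F[OF that] unfolding has_fps_expansion_def by (auto elim: eventually_mono)
  have R: "R \<in> cmod ` spectrum A"
    unfolding R_def using spectral_radius_mem_max(1)[OF A] assms(7) by auto
  have R0: "0 \<le> R" using R by auto
  have RMax: "R powr \<rho> \<le> Max ((\<lambda>l. cmod l powr \<rho>) ` spectrum A)"
    using R card_finite_spectrum(1)[OF A] by (auto intro!: Max_ge)
  have bound: "\<exists>C. \<forall>p. cmod (a p i) \<le> C * r ^ p" if "i < n" "R < r" for i r
  proof -
    have "spectral_radius A < r" "0 < r" using that(2) R0 by (auto simp: R_def)
    from linear_iteration_growth[where a = a, OF A this step that(1)] show ?thesis by blast
  qed
  have coeff: "cmod (fps_nth (F i) p) \<le> C * r ^ p / m p" if "cmod (a p i) \<le> C * r ^ p" for C r p i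
    using that m[of p] by (simp add: a_def norm_mult field_simps)
  obtain c k0 where k0: "k0 \<le> n" "c k0 \<noteq> 0"
    and rec: "\<And>p i. i < n \<Longrightarrow> (\<Sum>k\<le>n. c k * a (p + k) i) = 0"
    by (rule linear_iteration_annihilated[where a = a and n = n]) (erule step, rule that)
  have poly: "\<exists>p. eval_fps (F i) = poly p" if N: "\<And>p. N \<le> p \<Longrightarrow> a p i = 0" for N i
  proof -
    have "fps_nth (F i) k = 0" if "N \<le> k" for k
      using N[OF that] m[of k] by (simp add: a_def)
    then show ?thesis using eval_fps_finite_support by blast
  qed
  have large: "R \<noteq> 0 \<and> entire_order (eval_fps (F i)) = ereal \<rho> \<and> eval_fps (F i) holomorphic_on UNIV \<and>
      entire_type (eval_fps (F i)) \<le> ereal (R powr \<rho>)"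
    if i: "i < n" and C: "0 < C" "0 < \<kappa>"
      and low: "\<And>p. \<exists>q. p \<le> q \<and> q < p + L \<and> C * \<kappa> ^ q \<le> cmod (a q i)" for i L C \<kappa>
  proof -
    let ?f = "eval_fps (F i)"
    have growth: "\<forall>\<^sub>F x in at_top. ln_plus (max_modulus ?f x) \<le> c * x powr \<rho>"
      if r: "R < r" "r powr \<rho> < c" for r c
    proof -
      obtain C' where C': "\<And>p. cmod (a p i) \<le> C' * r ^ p" using bound[OF i r(1)] by blast
      show ?thesis
        by (rule growth_majorized[where m = m and r = r and C = C', OF m E contE assms(5,6) \<rho> _ coeff[OF C'] r(2)])
          (use r(1) R0 in simp)
    qed
    obtain C' where C': "\<And>p. cmod (a p i) \<le> C' * (R + 1) ^ p" using bound[OF i, of "R + 1"] by auto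
    have conv: "fps_conv_radius (F i) = \<infinity>"
      by (rule fps_conv_radius_majorized[where m = m, OF m E _ coeff[OF C']]) (use R0 in simp)
    \<comment> \<open>for \<open>R = 0\<close> the iterates are \<open>O((\<kappa> / 2)\<^sup>p)\<close>, against the lower bound in the windows\<close>
    have "R \<noteq> 0"
    proof
      assume "R = 0"
      then obtain C' where C': "\<And>p. cmod (a p i) \<le> C' * (\<kappa> / 2) ^ p"
        using bound[OF i, of "\<kappa> / 2"] C by auto
      obtain p where p: "C' / C < 2 ^ p" using real_arch_pow[of 2] by auto
      obtain q where q: "p \<le> q" "C * \<kappa> ^ q \<le> cmod (a q i)" using low by blast
      have "C * \<kappa> ^ q \<le> C' * (\<kappa> / 2) ^ q" using q(2) C'[of q] by linarith
      then have "2 ^ q \<le> C' / C" using C by (simp add: power_divide field_simps)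
      moreover have "(2::real) ^ p \<le> 2 ^ q" using q by simp
      ultimately show False using p by linarith
    qed
    have "ereal \<rho> \<le> entire_order ?f"
    proof (rule order_ge_if_coeffs_large[where m = m and D = "H ^ L" and L = L, OF m _ _ E contE assms(5,6) \<rho> conv C])
      show "0 < H ^ L" using H by simp
      show "m q \<le> (H ^ L) ^ q * m p" if "p \<le> q" "q < p + L" for p q
        using iterate_moment_ratio_bound[of m H, OF m H that] .
      show "\<exists>q\<ge>p. q < p + L \<and> C * \<kappa> ^ q \<le> m q * cmod (fps_nth (F i) q)" for p
        using low[of p] m by (auto simp: a_def norm_mult less_imp_le)
    qed
    moreover have "entire_order ?f \<le> ereal \<rho>"
      using growth[of "R + 1" "(R + 1) powr \<rho> + 1"] \<rho> by (intro entire_order_le) auto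
    ultimately have order: "entire_order ?f = ereal \<rho>" by simp
    have "entire_type ?f \<le> ereal (R powr \<rho>)"
    proof (rule ereal_le_epsilon2)
      fix \<epsilon> :: real assume "0 < \<epsilon>"
      then obtain r where "R < r" "r powr \<rho> < R powr \<rho> + \<epsilon>"
        using less_powr_obtain[of R \<rho> "R powr \<rho> + \<epsilon>"] R0 \<open>R \<noteq> 0\<close> \<rho> by auto
      from entire_type_le[OF order growth[OF this]]
      show "entire_type ?f \<le> ereal (R powr \<rho>) + ereal \<epsilon>" by simp
    qed
    moreover have "?f holomorphic_on UNIV" using conv by (intro holomorphic_on_eval_fps) auto
    ultimately show ?thesis using order \<open>R \<noteq> 0\<close> by blast
  qed
  have dichotomy: "(\<exists>p. eval_fps (F i) = poly p) \<or>
      R \<noteq> 0 \<and> entire_order (eval_fps (F i)) = ereal \<rho> \<and> eval_fps (F i) holomorphic_on UNIV \<and>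
      entire_type (eval_fps (F i)) \<le> ereal (R powr \<rho>)" if i: "i < n" for i
  proof (rule linear_recurrence_dichotomy[of k0 n c "\<lambda>p. a p i", OF k0 rec[OF i]])
    show ?thesis if "\<And>p. N \<le> p \<Longrightarrow> a p i = 0" for N using poly[OF that] by blast
    show ?thesis if "0 < C" "0 < \<kappa>" "\<And>p. \<exists>q\<ge>p. q < p + L \<and> C * \<kappa> ^ q \<le> cmod (a q i)" for C \<kappa> L
      using large[OF i that] by blast
  qed
  show ?thesis
  proof (intro conjI impI allI)
    fix i assume i: "i < n"
    show "\<exists>f. f holomorphic_on UNIV \<and> (\<forall>\<^sub>F z in nhds 0. y i z = f z) \<and>
               (entire_order f = ereal \<rho> \<and>
                  entire_type f \<le> ereal (Max ((\<lambda>l. cmod l powr \<rho>) ` spectrum A)) \<or>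
                entire_order f = 0)"
    proof (intro exI conjI)
      show "\<forall>\<^sub>F z in nhds 0. y i z = eval_fps (F i) z" by (rule ev[OF i])
      show "eval_fps (F i) holomorphic_on UNIV"
        using dichotomy[OF i]
      proof (elim disjE exE conjE)
        fix p assume p: "eval_fps (F i) = poly p"
        show ?thesis unfolding p poly_altdef by (intro holomorphic_intros)
      qed
      show "entire_order (eval_fps (F i)) = ereal \<rho> \<and>
          entire_type (eval_fps (F i)) \<le> ereal (Max ((\<lambda>l. cmod l powr \<rho>) ` spectrum A)) \<or>
          entire_order (eval_fps (F i)) = 0"
        using dichotomy[OF i]
      proof (elim disjE exE conjE)
        fix p assume "eval_fps (F i) = poly p"
        then show ?thesis by (simp add: entire_order_poly)
      next
        assume "entire_order (eval_fps (F i)) = ereal \<rho>" "entire_type (eval_fps (F i)) \<le> ereal (R powr \<rho>)"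
        then show ?thesis using RMax order_trans ereal_less_eq(3) by blast
      qed
    qed
  next
    fix i assume i: "i < n" and "spectrum A = {0}"
    then have "R = 0" using R by auto
    then obtain p where "eval_fps (F i) = poly p" using dichotomy[OF i] by blast
    then show "\<exists>p. (\<forall>\<^sub>F z in nhds 0. y i z = poly p z) \<and> entire_order (poly p) = 0"
      using ev[OF i] entire_order_poly by auto
  qed
qed

end
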